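(* Let $C(s)$ be the optimal cost (value) function. The following statements hold. (i) $C(s)$ is strictly decreasing in $s$. (ii) If the stage cost $g$ is convex, the optimal cost function $C(s)$ is also convex in $s$. (iii) If $C$ is continuously differentiable, then for all $s\in[0,\bar s]$ it satisfies the Hamilton–Jacobi–Bellman equation $$\frac{dC}{ds}=\frac{Q+\theta}{r}\,C(s)-\frac{Q}{r}\,\mathbf E\Big[\min_{u\in[0,\min\{s,W\}]}\big\{g(W-u)+C(s-u)\big\}\Big],$$ with the boundary condition $$\frac{dC}{ds}\Big|_{s=\bar s}=0.$$ Moreover, the optimal policy $\mu^*(s,w)$ achieves the optimal solution of the minimization problem in this equation (the minimization over $u$ of $g(w-u)+C(s-u)$ subject to $u\in[0,\min\{s,w\}]$). Furthermore, for a given policy $\mu$, if the cost function $C_\mu(s)$ is differentiable, it satisfies the delay differential equation $$\frac{dC_\mu}{ds}=\frac{Q+\theta}{r}\,C_\mu(s)-\frac{Q}{r}\,\mathbf E\Big[g\big(W-\mu(s,W)\big)+C_\mu\big(s-\mu(s,W)\big)\Big],$$ with the boundary condition $\frac{dC_\mu}{ds}\big|_{s=\bar s}=0$.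
   Context: Model. Fix constants $r>0$ (storage ramp rate), $Q>0$ (Poisson arrival rate), $\theta>0$ (discount rate), $\bar s\in(0,\infty)$ (storage capacity), $B\in(0,\infty)$. Shocks arrive at the arrival times $0<t_1<t_2<\cdots$ of a Poisson process of rate $Q$; the shock sizes $W_1,W_2,\dots$ are i.i.d. with a distribution $f_W$ supported in $[0,B]$ and independent of the arrival times; $W$ denotes a generic random variable with distribution $f_W$. A (stationary Markov) policy is a measurable function $\mu:[0,\bar s]\times[0,B]\to\mathbb R$ with $0\le\mu(s,w)\le\min\{s,w\}$; the set of all policies is $\Pi$. Under policy $\mu$ from initial state $s_0=s\in[0,\bar s]$, the storage level $s_t\in[0,\bar s]$ increases at rate $r$ between arrivals until it reaches $\bar s$, where it stays until the next arrival, and at each arrival time $t_k$ it jumps down: $s_{t_k}=s_{t_k^-}-\mu(s_{t_k^-},W_k)$. The stage cost $g:[0,B]\to\mathbb R$ is bounded, strictly increasing, continuously differentiable, with $g(0)=0$ and $\mathbf E[g(W)]>0$. The cost of policy $\mu$ is $$C_\mu(s)=\mathbf E\Big[\sum_{k=1}^\infty e^{-\theta t_k}\,g\big(W_k-\mu(s_{t_k^-},W_k)\big)\,\Big|\,s_0=s\Big],$$ and the value function is $C(s)=\min_{\mu\in\Pi}C_\mu(s)$, $0\le s\le\bar s$. A policy $\mu^*\in\Pi$ is optimal if $\mu^*\in\arg\min_{\mu\in\Pi}C_\mu(s)$.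
   Formalization: The delay equation is proved for almost every s and wherever its expectation term is continuous in s; its boundary condition is asserted if that term is continuous at s̄. Some optimal policy attains the minimum everywhere; every optimal policy does so for almost every (s,w). *)

theory Defs
  imports "HOL-Probability.Probability"
begin

(* One-sided derivatives at the boundary points of S; the library's C1_differentiable_on asks for
   derivatives in a full neighbourhood, which is meaningless for functions living on [0, B]. *)
definition continuously_differentiable_on :: "(real \<Rightarrow> real) \<Rightarrow> real set \<Rightarrow> bool" where
  "continuously_differentiable_on f S \<longleftrightarrow>
     (\<exists>f'. (\<forall>x\<in>S. (f has_real_derivative f' x) (at x within S)) \<and> continuous_on S f')"

(* T k is the k-th arrival time for k >= 1, and T 0 = 0 is the time origin.  Arrivals form a Poisson
   process of rate Q iff the gaps between them are i.i.d. exponential with parameter Q. *)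
definition poisson_arrival_times :: "'a measure \<Rightarrow> real \<Rightarrow> (nat \<Rightarrow> 'a \<Rightarrow> real) \<Rightarrow> bool" where
  "poisson_arrival_times M Q T \<longleftrightarrow>
     (\<forall>\<omega>\<in>space M. T 0 \<omega> = 0 \<and> (\<forall>k. T k \<omega> < T (Suc k) \<omega>)) \<and>
     (\<forall>k. distributed M lborel (\<lambda>\<omega>. T (Suc k) \<omega> - T k \<omega>) (exponential_density Q)) \<and>
     prob_space.indep_vars M (\<lambda>_. borel) (\<lambda>k \<omega>. T (Suc k) \<omega> - T k \<omega>) UNIV"

(* A distribution supported in [0, B] is a probability measure whose underlying space is [0, B],
   so that integrals against it never see values of g or of a policy outside their domains. *)
definition shock_distribution :: "real \<Rightarrow> real measure \<Rightarrow> bool" where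
  "shock_distribution B fW \<longleftrightarrow>
     prob_space fW \<and> sets fW = sets (restrict_space borel {0..B})"

(* The shock W k arrives at time T k; only the indices k >= 1 matter. *)
definition iid_shocks :: "'a measure \<Rightarrow> real measure \<Rightarrow> (nat \<Rightarrow> 'a \<Rightarrow> real) \<Rightarrow> bool" where
  "iid_shocks M fW W \<longleftrightarrow>
     (\<forall>k\<ge>1. W k \<in> measurable M fW \<and> distr M fW (W k) = fW) \<and>
     prob_space.indep_vars M (\<lambda>_. fW) W {1..}"

definition shocks_indep_of_arrivals ::
  "'a measure \<Rightarrow> real measure \<Rightarrow> (nat \<Rightarrow> 'a \<Rightarrow> real) \<Rightarrow> (nat \<Rightarrow> 'a \<Rightarrow> real) \<Rightarrow> bool" where
  "shocks_indep_of_arrivals M fW T W \<longleftrightarrow>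
     prob_space.indep_var M
       (Pi\<^sub>M UNIV (\<lambda>_. borel)) (\<lambda>\<omega> k. T (Suc k) \<omega>)
       (Pi\<^sub>M UNIV (\<lambda>_. fW)) (\<lambda>\<omega> k. W (Suc k) \<omega>)"

definition policies :: "real \<Rightarrow> real \<Rightarrow> (real \<Rightarrow> real \<Rightarrow> real) set" where
  "policies sbar B =
     {\<mu>. (\<lambda>(s, w). \<mu> s w) \<in> borel_measurable (restrict_space borel ({0..sbar} \<times> {0..B})) \<and>
         (\<forall>s\<in>{0..sbar}. \<forall>w\<in>{0..B}. 0 \<le> \<mu> s w \<and> \<mu> s w \<le> min s w)}"

(* Level reached from x when charging at rate r for a time \<tau> without an arrival.  The level at a
   time t between consecutive arrivals t k <= t < t (Suc k) is thus
   charge r sbar (level_after ... s k) (t - t k). *)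
definition charge :: "real \<Rightarrow> real \<Rightarrow> real \<Rightarrow> real \<Rightarrow> real" where
  "charge r sbar x \<tau> = min sbar (x + r * \<tau>)"

(* For a realisation t, w of arrival times and shock sizes, level_after ... s k is the level at t k
   (after the jump), started at s at time t 0 = 0. *)
primrec level_after ::
  "real \<Rightarrow> real \<Rightarrow> (real \<Rightarrow> real \<Rightarrow> real) \<Rightarrow> (nat \<Rightarrow> real) \<Rightarrow> (nat \<Rightarrow> real) \<Rightarrow> real \<Rightarrow> nat \<Rightarrow> real" where
  "level_after r sbar \<mu> t w s 0 = s"
| "level_after r sbar \<mu> t w s (Suc k) =
     (let x = charge r sbar (level_after r sbar \<mu> t w s k) (t (Suc k) - t k)
      in x - \<mu> x (w (Suc k)))"

(* The left limit of the level at the arrival time t k, for k >= 1. *)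
definition level_before ::
  "real \<Rightarrow> real \<Rightarrow> (real \<Rightarrow> real \<Rightarrow> real) \<Rightarrow> (nat \<Rightarrow> real) \<Rightarrow> (nat \<Rightarrow> real) \<Rightarrow> real \<Rightarrow> nat \<Rightarrow> real" where
  "level_before r sbar \<mu> t w s k =
     charge r sbar (level_after r sbar \<mu> t w s (k - 1)) (t k - t (k - 1))"

definition policy_cost ::
  "'a measure \<Rightarrow> (nat \<Rightarrow> 'a \<Rightarrow> real) \<Rightarrow> (nat \<Rightarrow> 'a \<Rightarrow> real) \<Rightarrow> real \<Rightarrow> real \<Rightarrow> real \<Rightarrow>
   (real \<Rightarrow> real) \<Rightarrow> (real \<Rightarrow> real \<Rightarrow> real) \<Rightarrow> real \<Rightarrow> real" where
  "policy_cost M T W r \<theta> sbar g \<mu> s =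
     (\<integral>\<omega>. (\<Sum>n. let k = Suc n; x = level_before r sbar \<mu> (\<lambda>i. T i \<omega>) (\<lambda>i. W i \<omega>) s k
                in exp (- \<theta> * T k \<omega>) * g (W k \<omega> - \<mu> x (W k \<omega>))) \<partial>M)"

definition value_function ::
  "'a measure \<Rightarrow> (nat \<Rightarrow> 'a \<Rightarrow> real) \<Rightarrow> (nat \<Rightarrow> 'a \<Rightarrow> real) \<Rightarrow> real \<Rightarrow> real \<Rightarrow> real \<Rightarrow> real \<Rightarrow>
   (real \<Rightarrow> real) \<Rightarrow> real \<Rightarrow> real" where
  "value_function M T W r \<theta> sbar B g s =
     (INF \<mu>\<in>policies sbar B. policy_cost M T W r \<theta> sbar g \<mu> s)"

definition optimal_policy ::
  "'a measure \<Rightarrow> (nat \<Rightarrow> 'a \<Rightarrow> real) \<Rightarrow> (nat \<Rightarrow> 'a \<Rightarrow> real) \<Rightarrow> real \<Rightarrow> real \<Rightarrow> real \<Rightarrow> real \<Rightarrow>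
   (real \<Rightarrow> real) \<Rightarrow> (real \<Rightarrow> real \<Rightarrow> real) \<Rightarrow> bool" where
  "optimal_policy M T W r \<theta> sbar B g \<mu> \<longleftrightarrow>
     (\<forall>s\<in>{0..sbar}.
        is_arg_min (\<lambda>\<nu>. policy_cost M T W r \<theta> sbar g \<nu> s) (\<lambda>\<nu>. \<nu> \<in> policies sbar B) \<mu>)"

definition minimizing_discharge ::
  "(real \<Rightarrow> real) \<Rightarrow> (real \<Rightarrow> real) \<Rightarrow> real \<Rightarrow> real \<Rightarrow> real \<Rightarrow> bool" where
  "minimizing_discharge g V s w u \<longleftrightarrow>
     is_arg_min (\<lambda>v. g (w - v) + V (s - v)) (\<lambda>v. v \<in> {0..min s w}) u"

(* E[min over u in [0, min {s, W}] of g(W - u) + V(s - u)] *)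
definition min_shock_cost :: "real measure \<Rightarrow> (real \<Rightarrow> real) \<Rightarrow> (real \<Rightarrow> real) \<Rightarrow> real \<Rightarrow> real" where
  "min_shock_cost fW g V s = (\<integral>w. (INF u\<in>{0..min s w}. g (w - u) + V (s - u)) \<partial>fW)"

(* E[g(W - \<mu>(s, W)) + V(s - \<mu>(s, W))].  Policies are merely measurable, so this need not be
   continuous in s even if V is the cost of \<mu> and V is smooth.  In that case the cost does not
   determine the value at an individual s < sbar: from every initial state, the levels below sbar
   at which shocks arrive have a continuous distribution. *)
definition shock_cost ::
  "real measure \<Rightarrow> (real \<Rightarrow> real) \<Rightarrow> (real \<Rightarrow> real) \<Rightarrow> (real \<Rightarrow> real \<Rightarrow> real) \<Rightarrow> real \<Rightarrow> real" where
  "shock_cost fW g V \<mu> s = (\<integral>w. g (w - \<mu> s w) + V (s - \<mu> s w) \<partial>fW)"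

end

theory Submission
  imports Defs
begin

text \<open>
  Nothing is decided between two shocks, so the problem renews itself at the first arrival. Let \<open>\<tau>\<close>
  be the first arrival time and put
  \<open>renewal h s = E [exp (- \<theta> \<tau>) h (min sbar (s + r \<tau>))]\<close>. The cost of a policy \<open>\<mu>\<close>
  then solves \<open>Cpol \<mu> = renewal (shock_cost (Cpol \<mu>) \<mu>)\<close> on \<open>[0, sbar]\<close>
  (\<open>cost_renewal\<close>, \<open>policy_cost_eq_cost\<close>). This is where the Poisson process enters: the gaps
  and the shocks form a sequence of independent, identically distributed pairs, and removing the first
  pair leaves a sequence with the same law. Everything else follows from two features of \<open>renewal\<close>.

  The first feature is contraction: since \<open>E [exp (- \<theta> \<tau>)] = q = Q / (Q + \<theta>) < 1\<close>, an estimate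
  \<open>f \<le> D\<close> that improves to \<open>f \<le> q * D\<close> for every \<open>D\<close> forces \<open>f \<le> 0\<close>
  (\<open>nonpos_of_contraction\<close>). Costs of policies are Lipschitz with a common constant, hence so is
  their infimum \<open>C\<close>, and minimising \<open>g (w - u) + C (s - u)\<close> over \<open>u\<close> yields a measurable
  policy. Its excess cost over \<open>C\<close> contracts, so this greedy policy attains \<open>C\<close>, and
  \<open>C = renewal U\<close> with \<open>U = min_shock_cost C\<close> (\<open>C_renewal\<close>). Monotonicity and
  convexity of \<open>C\<close> follow in the same way, with \<open>f\<close> measuring the failure of the property.

  The second feature is smoothing: \<open>exp (- rate * s) * renewal h s\<close>, where
  \<open>rate = (Q + \<theta>) / r\<close>, is the integral of \<open>Q / r * exp (- rate * y) * h y\<close> over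
  \<open>y \<ge> s\<close>, with \<open>h\<close> extended by the constant \<open>h sbar\<close> (\<open>renewal_eq_tail_integral\<close>).
  Differentiating gives \<open>rate * renewal h s - Q / r * h s\<close> wherever \<open>h\<close> is continuous, and
  almost everywhere if \<open>renewal h\<close> is differentiable. As \<open>U\<close> is Lipschitz, this is the
  Hamilton--Jacobi--Bellman equation at every level. At \<open>s = sbar\<close> the level is stuck, so
  \<open>renewal h sbar = q * h sbar\<close>, which is the boundary condition.

  An optimal policy has \<open>renewal (shock_cost C \<mu>) = renewal U\<close> although
  \<open>U \<le> shock_cost C \<mu>\<close>; equality of the integrals makes the integrands agree almost everywhere.
  Strict monotonicity is proved by contradiction: if \<open>C\<close> were flat somewhere, it would be flat up to
  \<open>sbar\<close>; at the least level \<open>z\<close> with \<open>C z = C sbar\<close> a shock \<open>w > 0\<close> would have to be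
  covered completely, and then \<open>C (z - w) = C sbar\<close>, so that \<open>z\<close> was not the least such level.
\<close>

section \<open>Differentiation almost everywhere and measurable minimisers\<close>

text \<open>
  Since \<open>F\<close> is differentiable on all of \<open>[a, b]\<close>, the fundamental theorem of calculus gives
  \<open>F'\<close> the same integral as \<open>\<phi>\<close> over every subinterval. After adding \<open>c\<close>, both are
  nonnegative, and as densities they give the same mass to every half-line; hence they define the same measure.
\<close>

lemma AE_deriv_eq_integrand:
  fixes F F' \<phi> :: "real \<Rightarrow> real"
  assumes meas [measurable]: "\<phi> \<in> borel_measurable borel"
    and bound: "\<And>x. x \<in> {a..b} \<Longrightarrow> \<bar>\<phi> x\<bar> \<le> c"
    and incr: "\<And>x y. a \<le> x \<Longrightarrow> x \<le> y \<Longrightarrow> y \<le> b \<Longrightarrow> (\<phi> has_integral (F y - F x)) {x..y}"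
    and deriv: "\<And>x. x \<in> {a..b} \<Longrightarrow> (F has_real_derivative F' x) (at x within {a..b})"
  shows "AE x in lborel. x \<in> {a..b} \<longrightarrow> F' x = \<phi> x"
proof (cases "a < b")
  case False
  have "AE x in lborel. x \<noteq> a" by (rule AE_lborel_singleton)
  then show ?thesis
  proof eventually_elim
    case (elim x)
    then show ?case using False by auto
  qed
next
  case True
  note ab = this
  have c0: "0 \<le> c" using bound[of a] ab by auto
  have lip: "F y - F x \<ge> - c * (y - x)" if "a \<le> x" "x \<le> y" "y \<le> b" for x y
  proof -
    have "((\<lambda>_. - c) has_integral (- c * (y - x))) {x..y}"
      using has_integral_const_real[of "- c" x y] that by (simp add: mult.commute)
    then show ?thesis
    proof (rule has_integral_le[OF _ incr[OF that]])
      fix z assume "z \<in> {x..y}"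
      then show "- c \<le> \<phi> z" using bound[of z] that by (auto simp: abs_le_iff)
    qed
  qed
  have cont: "continuous_on {a..b} F"
    using deriv by (meson DERIV_continuous continuous_on_eq_continuous_within)
  define Fc where "Fc x = F (max a (min b x))" for x
  have "continuous_on UNIV (F \<circ> (\<lambda>x. max a (min b x)))"
    by (intro continuous_on_compose continuous_intros continuous_on_subset[OF cont]) (use ab in auto)
  then have "continuous_on UNIV Fc" by (simp add: Fc_def o_def)
  then have Fc_meas [measurable]: "Fc \<in> borel_measurable borel"
    by (rule borel_measurable_continuous_onI)
  have quot: "(\<lambda>n. (Fc (x + 1 / real (Suc n)) - Fc x) * real (Suc n)) \<longlonglongrightarrow> F' x" if x: "x \<in> {a<..<b}" for x
  proof -
    have "(F has_real_derivative F' x) (at x)"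
      using deriv[of x] at_within_Icc_at[of a x b] x by auto
    then have "(\<lambda>h. (F (x + h) - F x) / h) \<midarrow>0\<rightarrow> F' x"
      by (simp add: DERIV_def)
    then have "(\<lambda>n. (F (x + 1 / real (Suc n)) - F x) / (1 / real (Suc n))) \<longlonglongrightarrow> F' x"
      by (rule filterlim_compose)
         (use LIMSEQ_inverse_real_of_nat in \<open>auto intro!: filterlim_atI simp: inverse_eq_divide\<close>)
    moreover have "eventually (\<lambda>n. x + 1 / real (Suc n) < b) sequentially"
    proof -
      have "(\<lambda>n. x + 1 / real (Suc n)) \<longlonglongrightarrow> x + 0"
        by (intro tendsto_intros) (use LIMSEQ_inverse_real_of_nat in \<open>auto simp: inverse_eq_divide\<close>)
      then show ?thesis using x by (intro order_tendstoD(2)[of _ "x + 0"]) auto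
    qed
    then have "eventually (\<lambda>n. (F (x + 1 / real (Suc n)) - F x) / (1 / real (Suc n))
        = (Fc (x + 1 / real (Suc n)) - Fc x) * real (Suc n)) sequentially"
    proof eventually_elim
      case (elim n)
      have "a \<le> x + 1 / real (Suc n)" using x by (smt (verit) divide_nonneg_nonneg greaterThanLessThan_iff of_nat_0_le_iff)
      then have "Fc (x + 1 / real (Suc n)) = F (x + 1 / real (Suc n))"
        using elim by (simp add: Fc_def min_absorb2 max_absorb2)
      moreover have "Fc x = F x" using x by (simp add: Fc_def)
      ultimately show ?case by simp
    qed
    ultimately show ?thesis by (rule Lim_transform_eventually)
  qed
  define D where "D x = (if x \<in> {a<..<b} then F' x + c else 0)" for x
  define E where "E x = (if x \<in> {a<..<b} then \<phi> x + c else 0)" for x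
  have E_meas [measurable]: "E \<in> borel_measurable borel" unfolding E_def by measurable
  have D_meas [measurable]: "D \<in> borel_measurable borel"
  proof (rule borel_measurable_LIMSEQ_real)
    show "(\<lambda>n. if x \<in> {a<..<b} then (Fc (x + 1 / real (Suc n)) - Fc x) * real (Suc n) + c else 0) \<longlonglongrightarrow> D x" for x
      unfolding D_def using quot[of x] by (auto intro!: tendsto_intros)
  qed measurable
  have D0: "0 \<le> D x" for x
  proof (cases "x \<in> {a<..<b}")
    case True
    have "- c \<le> (Fc (x + 1 / real (Suc n)) - Fc x) * real (Suc n)" for n
    proof -
      let ?y = "min b (x + 1 / real (Suc n))"
      have "?y \<ge> x" using True by auto
      have "Fc (x + 1 / real (Suc n)) = F ?y" "Fc x = F x"
        using True \<open>?y \<ge> x\<close> order_trans[of a x ?y]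
        by (auto simp: Fc_def simp del: of_nat_Suc intro!: arg_cong[where f=F] max_absorb2)
      moreover have "F ?y - F x \<ge> - c * (?y - x)"
        by (rule lip) (use True \<open>?y \<ge> x\<close> in auto)
      ultimately have "Fc (x + 1 / real (Suc n)) - Fc x \<ge> - c * (?y - x)" by simp
      also have "- c * (?y - x) \<ge> - c * (1 / real (Suc n))"
        using c0 by (intro mult_left_mono_neg) auto
      finally have "- c * (1 / real (Suc n)) * real (Suc n) \<le> (Fc (x + 1 / real (Suc n)) - Fc x) * real (Suc n)"
        by (intro mult_right_mono) auto
      then show ?thesis by simp
    qed
    then have "- c \<le> F' x"
      by (intro LIMSEQ_le_const[OF quot[OF True]]) blast
    then show ?thesis by (simp add: D_def)
  qed (auto simp: D_def)
  have E0: "0 \<le> E x" for x using bound[of x] by (auto simp: E_def abs_le_iff)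
  have tail: "(\<integral>\<^sup>+y. ennreal (H y) * indicator {x<..} y \<partial>lborel)
        = (if x < b then ennreal (F b - F (max a x) + c * (b - max a x)) else 0)"
    if H: "H = (\<lambda>y. if y \<in> {a<..<b} then f y + c else 0)" "H \<in> borel_measurable borel" "\<And>y. 0 \<le> H y"
      and f: "\<And>x. a \<le> x \<Longrightarrow> x \<le> b \<Longrightarrow> (f has_integral (F b - F x)) {x..b}" for H f x
  proof (cases "x < b")
    case True
    note [measurable] = H(2)
    let ?x = "max a x"
    have x: "a \<le> ?x" "?x \<le> b" using True ab by auto
    have "((\<lambda>y. f y + c) has_integral (F b - F ?x + c * (b - ?x))) {?x..b}"
      using has_integral_add[OF f[OF x] has_integral_const_real[of c ?x b]] x by (simp add: mult.commute)
    then have "((\<lambda>y. f y + c) has_integral (F b - F ?x + c * (b - ?x))) {?x<..<b}"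
      by (simp add: has_integral_Icc_iff_Ioo)
    then have "((\<lambda>y. if y \<in> {?x<..<b} then f y + c else 0) has_integral (F b - F ?x + c * (b - ?x))) UNIV"
      by (simp only: has_integral_restrict_UNIV)
    also have "(\<lambda>y. if y \<in> {?x<..<b} then f y + c else 0) = (\<lambda>y. H y * indicator {x<..} y)"
      by (auto simp: H(1) fun_eq_iff)
    finally have "(\<integral>\<^sup>+y. ennreal (H y * indicator {x<..} y) \<partial>lborel) = ennreal (F b - F ?x + c * (b - ?x))"
      by (intro nn_integral_has_integral_lborel) (use H(3) in auto)
    moreover have "ennreal (H y * indicator {x<..} y) = ennreal (H y) * indicator {x<..} y" for y
      by (auto split: split_indicator)
    ultimately show ?thesis using True by simp
  next
    case False
    then have "ennreal (H y) * indicator {x<..} y = 0" for y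
      by (auto simp: H(1) split: split_indicator)
    then show ?thesis using False by (simp del: mult_eq_0_iff)
  qed
  have FTC: "(F' has_integral (F b - F x)) {x..b}" if "a \<le> x" "x \<le> b" for x
    by (rule fundamental_theorem_of_calculus[OF that(2)])
       (use that in \<open>auto simp flip: has_real_derivative_iff_has_vector_derivative intro!: DERIV_subset[OF deriv]\<close>)
  have "density lborel (\<lambda>x. ennreal (D x)) = density lborel (\<lambda>x. ennreal (E x))"
  proof (rule measure_eqI_lessThan)
    fix x
    have D: "emeasure (density lborel (\<lambda>x. ennreal (D x))) {x<..} =
         (if x < b then ennreal (F b - F (max a x) + c * (b - max a x)) else 0)"
      by (subst emeasure_density) (simp_all add: tail[OF ext[OF D_def] D_meas D0 FTC])
    then show "emeasure (density lborel (\<lambda>x. ennreal (D x))) {x<..} < \<infinity>" by auto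
    have "emeasure (density lborel (\<lambda>x. ennreal (E x))) {x<..} =
         (if x < b then ennreal (F b - F (max a x) + c * (b - max a x)) else 0)"
      by (subst emeasure_density) (simp_all add: tail[OF ext[OF E_def] E_meas E0 incr[OF _ _ order_refl]])
    with D show "emeasure (density lborel (\<lambda>x. ennreal (D x))) {x<..} = emeasure (density lborel (\<lambda>x. ennreal (E x))) {x<..}"
      by simp
  qed auto
  then have "AE x in lborel. ennreal (D x) = ennreal (E x)"
    by (subst (asm) sigma_finite_measure.density_unique_iff[OF sigma_finite_lborel]) auto
  moreover have "AE x in lborel. x \<noteq> a" "AE x in lborel. x \<noteq> b" by (rule AE_lborel_singleton)+
  ultimately show ?thesis
  proof eventually_elim
    case (elim x)
    show ?case
    proof
      assume "x \<in> {a..b}"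
      then have "x \<in> {a<..<b}" using elim by auto
      moreover have "D x = E x" using elim(1) D0 E0 by simp
      ultimately show "F' x = \<phi> x" by (simp add: D_def E_def)
    qed
  qed
qed

lemma closure_rational_unit_interval: "closure (\<rat> \<inter> {0..1::real}) = {0..1}"
proof
  have "{0..1::real} = closure ({0<..<1} \<inter> \<rat>)"
    by (subst closure_open_Int_superset) (auto simp: Rats_closure_real)
  also have "\<dots> \<subseteq> closure (\<rat> \<inter> {0..1})" by (intro closure_mono) auto
  finally show "{0..1::real} \<subseteq> closure (\<rat> \<inter> {0..1})" .
  show "closure (\<rat> \<inter> {0..1::real}) \<subseteq> {0..1}" by (rule closure_minimal) auto
qed

text \<open>
  Having a minimiser in \<open>[0, a]\<close> is expressed by countably many comparisons of values of \<open>f\<close>,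
  which is what makes the least minimiser measurable in a parameter.
\<close>

lemma argmin_le_iff_rational:
  fixes f :: "real \<Rightarrow> real"
  assumes cont: "continuous_on {0..1} f" and a: "0 \<le> a" "a \<le> 1"
  shows "(\<exists>v\<in>{0..a}. \<forall>v'\<in>{0..1}. f v \<le> f v') \<longleftrightarrow>
    (\<forall>n. \<exists>t\<in>\<rat> \<inter> {0..1}. \<forall>v'\<in>\<rat> \<inter> {0..1}. f (a * t) < f v' + 1 / real (Suc n))"
proof
  assume "\<exists>v\<in>{0..a}. \<forall>v'\<in>{0..1}. f v \<le> f v'"
  then obtain v where v: "v \<in> {0..a}" and le: "\<And>v'. v' \<in> {0..1} \<Longrightarrow> f v \<le> f v'" by blast
  have scaled: "continuous_on {0..1} (\<lambda>t. f (a * t))"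
  proof (rule continuous_on_compose2[OF cont])
    show "(*) a ` {0..1} \<subseteq> {0..1}"
    proof (intro image_subsetI)
      fix t :: real assume "t \<in> {0..1}"
      then show "a * t \<in> {0..1}" using a mult_le_one[of a t] by simp
    qed
  qed (intro continuous_intros)
  show "\<forall>n. \<exists>t\<in>\<rat> \<inter> {0..1}. \<forall>v'\<in>\<rat> \<inter> {0..1}. f (a * t) < f v' + 1 / real (Suc n)"
  proof (rule ccontr)
    assume "\<not> ?thesis"
    then obtain n where n: "\<not> (\<exists>t\<in>\<rat> \<inter> {0..1}. \<forall>v'\<in>\<rat> \<inter> {0..1}. f (a * t) < f v' + 1 / real (Suc n))"
      by blast
    have gap: "f v + 1 / real (Suc n) \<le> f (a * t)" if "t \<in> \<rat> \<inter> {0..1}" for t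
    proof (rule ccontr)
      assume "\<not> ?thesis"
      then have "f (a * t) < f v' + 1 / real (Suc n)" if "v' \<in> \<rat> \<inter> {0..1}" for v'
        using le[of v'] that by simp
      then show False using n \<open>t \<in> \<rat> \<inter> {0..1}\<close> by blast
    qed
    have "v / a \<in> {0..1}" using v a by (cases "a = 0") (simp_all add: divide_le_eq_1)
    then have "f v + 1 / real (Suc n) \<le> f (a * (v / a))"
      using gap scaled
      by (intro continuous_ge_on_closure[where S="\<rat> \<inter> {0..1}" and f="\<lambda>t. f (a * t)" and x="v / a"])
         (simp_all add: closure_rational_unit_interval)
    moreover have "a * (v / a) = v" using v by (cases "a = 0") auto
    ultimately have "1 / real (Suc n) \<le> 0" by simp
    then show False by (simp add: field_simps)
  qed
next
  assume approx: "\<forall>n. \<exists>t\<in>\<rat> \<inter> {0..1}. \<forall>v'\<in>\<rat> \<inter> {0..1}. f (a * t) < f v' + 1 / real (Suc n)"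
  obtain v where v: "v \<in> {0..a}" and min: "\<And>y. y \<in> {0..a} \<Longrightarrow> f v \<le> f y"
    using continuous_attains_inf[of "{0..a}" f] continuous_on_subset[OF cont, of "{0..a}"] a by auto
  have "f v \<le> f v'" if v': "v' \<in> \<rat> \<inter> {0..1}" for v'
  proof (rule field_le_epsilon)
    fix e :: real assume "0 < e"
    then obtain n where n: "1 / real (Suc n) < e" using nat_approx_posE by blast
    obtain t where "t \<in> \<rat> \<inter> {0..1}" "\<forall>v'\<in>\<rat> \<inter> {0..1}. f (a * t) < f v' + 1 / real (Suc n)"
      using spec[OF approx, of n] by (rule bexE)
    then have t: "t \<in> {0..1}" "f (a * t) < f v' + 1 / real (Suc n)" using v' by auto
    have "a * t \<in> {0..a}" using t a mult_left_le[of t a] by auto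
    then show "f v \<le> f v' + e" using min t n by force
  qed
  then have "f v \<le> f v'" if "v' \<in> {0..1}" for v'
    using that cont
    by (intro continuous_ge_on_closure[where S="\<rat> \<inter> {0..1}" and f=f and x=v'])
       (simp_all add: closure_rational_unit_interval)
  with v show "\<exists>v\<in>{0..a}. \<forall>v'\<in>{0..1}. f v \<le> f v'" by blast
qed

text \<open>
  The selection is the least minimiser: it is at most \<open>a\<close> if and only if \<open>[0, a]\<close> contains a
  minimiser.
\<close>

lemma measurable_argmin:
  fixes f :: "'b \<Rightarrow> real \<Rightarrow> real"
  assumes meas: "\<And>v. v \<in> {0..1} \<Longrightarrow> (\<lambda>x. f x v) \<in> borel_measurable N"
    and cont: "\<And>x. x \<in> space N \<Longrightarrow> continuous_on {0..1} (f x)"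
  obtains v where "v \<in> borel_measurable N"
    and "\<And>x. x \<in> space N \<Longrightarrow> v x \<in> {0..1} \<and> (\<forall>v'\<in>{0..1}. f x (v x) \<le> f x v')"
proof -
  define A where "A x = {v \<in> {0..1}. \<forall>v'\<in>{0..1}. f x v \<le> f x v'}" for x
  have A_eq: "A x = {0..1} \<inter> (\<Inter>v'\<in>{0..1}. {v \<in> {0..1}. f x v \<le> f x v'})" for x
    by (auto simp: A_def)
  have closed: "closed (A x)" if "x \<in> space N" for x
    unfolding A_eq
    by (intro closed_Int closed_INT ballI continuous_on_closed_Collect_le cont that continuous_intros)
  have A_ne: "A x \<noteq> {}" if "x \<in> space N" for x
    using continuous_attains_inf[OF _ _ cont[OF that]] by (auto simp: A_def)
  have bdd: "bdd_below (A x)" for x by (auto simp: A_def intro: bdd_belowI[of _ 0])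
  define v where "v x = Inf (A x)" for x
  have v: "v x \<in> A x" if "x \<in> space N" for x
    unfolding v_def using closed_contains_Inf[OF A_ne bdd closed] that by blast
  have v_le: "v x \<le> a \<longleftrightarrow> (\<exists>y\<in>{0..a}. \<forall>v'\<in>{0..1}. f x y \<le> f x v')" if x: "x \<in> space N" and a: "a \<le> 1" for x a
  proof
    assume "v x \<le> a"
    then show "\<exists>y\<in>{0..a}. \<forall>v'\<in>{0..1}. f x y \<le> f x v'" using v[OF x] by (auto simp: A_def)
  next
    assume "\<exists>y\<in>{0..a}. \<forall>v'\<in>{0..1}. f x y \<le> f x v'"
    then obtain y where "y \<in> A x" "y \<le> a" using a by (auto simp: A_def)
    then show "v x \<le> a" unfolding v_def using cInf_lower[OF _ bdd] by force
  qed
  have "v \<in> borel_measurable N"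
  proof (subst borel_measurable_iff_le, intro allI)
    fix a :: real
    consider "a < 0" | "1 < a" | "0 \<le> a" "a \<le> 1" by linarith
    then show "{x \<in> space N. v x \<le> a} \<in> sets N"
    proof cases
      case 1
      then have "{x \<in> space N. v x \<le> a} = {}" using v by (force simp: A_def)
      then show ?thesis by (simp only: sets.top sets.empty_sets)
    next
      case 2
      then have "{x \<in> space N. v x \<le> a} = space N" using v by (force simp: A_def)
      then show ?thesis by (simp only: sets.top sets.empty_sets)
    next
      case 3
      have [measurable]: "(\<lambda>x. f x v') \<in> borel_measurable N" if "v' \<in> \<rat> \<inter> {0..1}" for v'
        using that meas by auto
      have [measurable]: "(\<lambda>x. f x (a * t)) \<in> borel_measurable N" if "t \<in> \<rat> \<inter> {0..1}" for t
        using that 3 by (intro meas) (auto intro: mult_le_one)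
      have ctb [simp]: "countable (\<rat> \<inter> {0..1::real})" by (simp add: countable_rat)
      have "{x \<in> space N. v x \<le> a} = {x \<in> space N. \<forall>n. \<exists>t\<in>\<rat> \<inter> {0..1}. \<forall>v'\<in>\<rat> \<inter> {0..1}.
          f x (a * t) < f x v' + 1 / real (Suc n)}"
        by (intro Collect_cong conj_cong refl)
           (simp only: v_le[OF _ 3(2)] argmin_le_iff_rational[OF cont 3])
      also have "\<dots> \<in> sets N"
        by (intro predE pred_intros_countable pred_intros_countable_bounded ctb) measurable
      finally show ?thesis .
    qed
  qed
  with v show thesis by (intro that[of v]) (auto simp: A_def)
qed

lemma continuously_differentiable_imp_lipschitz:
  assumes "continuously_differentiable_on f {a..b}"
  obtains L where "L-lipschitz_on {a..b} f"
proof -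
  obtain f' where f': "\<forall>x\<in>{a..b}. (f has_real_derivative f' x) (at x within {a..b})"
    and cont: "continuous_on {a..b} f'"
    using assms unfolding continuously_differentiable_on_def by auto
  have "bounded (f' ` {a..b})"
    by (intro compact_imp_bounded compact_continuous_image cont) simp
  then obtain L where L: "0 < L" "\<And>x. x \<in> {a..b} \<Longrightarrow> \<bar>f' x\<bar> \<le> L"
    unfolding bounded_pos by auto
  have "L-lipschitz_on {a..b} f"
  proof (rule lipschitz_onI)
    show "dist (f x) (f y) \<le> L * dist x y" if "x \<in> {a..b}" "y \<in> {a..b}" for x y
      using field_differentiable_bound[of "{a..b}" f f' L x y] bspec[OF f'] L(2) that
      by (simp add: dist_norm)
  qed (use L(1) in simp)
  then show thesis by (rule that)
qed

text \<open>
  Applied with \<open>D\<close> the supremum of \<open>f\<close>: from \<open>D \<le> q * D\<close> and \<open>q < 1\<close> one gets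
  \<open>D \<le> 0\<close>.
\<close>

lemma nonpos_of_contraction:
  fixes f :: "'b \<Rightarrow> real"
  assumes "bdd_above (f ` S)" "q < 1"
    and step: "\<And>D. (\<And>x. x \<in> S \<Longrightarrow> f x \<le> D) \<Longrightarrow> (\<And>x. x \<in> S \<Longrightarrow> f x \<le> q * D)"
    and x: "x \<in> S"
  shows "f x \<le> 0"
proof -
  let ?D = "SUP x\<in>S. f x"
  have "f y \<le> q * ?D" if "y \<in> S" for y
    using step[of ?D y] cSUP_upper[OF _ assms(1)] that by blast
  then have "?D \<le> q * ?D" using x by (intro cSUP_least) auto
  then have "(1 - q) * ?D \<le> 0" by (simp add: algebra_simps)
  then have "?D \<le> 0" using \<open>q < 1\<close> by (simp add: mult_le_0_iff)
  then show ?thesis using cSUP_upper[OF x assms(1)] by simp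
qed

section \<open>Discounted expectation at the next arrival\<close>

text \<open>
  The passage from one shock to the next involves the charging rate, the arrival rate, the discount
  rate and the capacity, but neither costs nor policies.
\<close>

locale charging =
  fixes r Q \<theta> sbar :: real
  assumes r_pos: "0 < r" and Q_pos: "0 < Q" and \<theta>_pos: "0 < \<theta>" and sbar_pos: "0 < sbar"
begin

text \<open>
  Clamping to \<open>[0, sbar]\<close> agrees with charging from a level in this interval, and it turns
  functions that matter only on \<open>[0, sbar]\<close> into functions on the whole line.
\<close>

definition cap :: "real \<Rightarrow> real" where
  "cap y = max 0 (min sbar y)"

definition contraction_factor :: real where
  "contraction_factor = Q / (Q + \<theta>)"

definition rate :: real where
  "rate = (Q + \<theta>) / r"

text \<open>
  Discounting at rate \<open>\<theta>\<close> amounts to killing the process at rate \<open>\<theta>\<close>: it replaces an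
  exponential time of rate \<open>Q\<close> by one of rate \<open>Q + \<theta>\<close>, at the price of the survival
  probability \<open>contraction_factor\<close>. This leaves a probability measure to integrate against.
\<close>

definition gap :: "real measure" where
  "gap = density lborel (exponential_density (Q + \<theta>))"

text \<open>
  This is \<open>E [exp (- \<theta> \<tau>) h (cap (s + r \<tau>))]\<close> for an exponential time \<open>\<tau>\<close> of rate \<open>Q\<close>.
\<close>

definition renewal :: "(real \<Rightarrow> real) \<Rightarrow> real \<Rightarrow> real" where
  "renewal h s = contraction_factor * (\<integral>a. h (cap (s + r * a)) \<partial>gap)"

definition bounded_measurable :: "(real \<Rightarrow> real) \<Rightarrow> bool" where
  "bounded_measurable h \<longleftrightarrow> (\<lambda>y. h (cap y)) \<in> borel_measurable borel \<and> bounded (h ` {0..sbar})"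

lemma cap_in [simp]: "cap y \<in> {0..sbar}" "0 \<le> cap y" "cap y \<le> sbar"
  using sbar_pos by (auto simp: cap_def)

lemma cap_id [simp]: "y \<in> {0..sbar} \<Longrightarrow> cap y = y"
  by (auto simp: cap_def)

lemma cap_id' [simp]: "0 \<le> y \<Longrightarrow> y \<le> sbar \<Longrightarrow> cap y = y"
  by (auto simp: cap_def)

lemma cap_ge [simp]: "sbar \<le> y \<Longrightarrow> cap y = sbar"
  using sbar_pos by (auto simp: cap_def)

lemma cap_mono: "x \<le> y \<Longrightarrow> cap x \<le> cap y"
  by (auto simp: cap_def)

lemma cap_measurable [measurable]: "cap \<in> borel_measurable borel"
  unfolding cap_def[abs_def] by measurable

lemma contraction_factor_pos: "0 < contraction_factor" and contraction_factor_less_1: "contraction_factor < 1"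
  using Q_pos \<theta>_pos by (auto simp: contraction_factor_def)

lemma rate_pos: "0 < rate"
  using Q_pos \<theta>_pos r_pos by (simp add: rate_def)

lemma rate_contraction: "rate * contraction_factor = Q / r"
  using Q_pos \<theta>_pos r_pos by (simp add: rate_def contraction_factor_def)

lemma prob_space_gap: "prob_space gap"
  unfolding gap_def using Q_pos \<theta>_pos by (intro prob_space_exponential_density) simp

sublocale gap: prob_space gap
  by (rule prob_space_gap)

lemma sets_gap [simp, measurable_cong]: "sets gap = sets borel" and space_gap [simp]: "space gap = UNIV"
  by (simp_all add: gap_def)

lemma AE_gap_iff: "(AE a in gap. P a) \<longleftrightarrow> (AE a in lborel. 0 \<le> a \<longrightarrow> P a)"
proof -
  have "0 < exponential_density (Q + \<theta>) a \<longleftrightarrow> 0 \<le> a" for a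
    using Q_pos \<theta>_pos by (auto simp: exponential_density_def zero_less_mult_iff)
  then show ?thesis
    unfolding gap_def by (subst AE_density) simp_all
qed

lemma bounded_measurableI:
  assumes "(\<lambda>y. h (cap y)) \<in> borel_measurable borel" "\<And>x. x \<in> {0..sbar} \<Longrightarrow> \<bar>h x\<bar> \<le> c"
  shows "bounded_measurable h"
  using assms unfolding bounded_measurable_def bounded_iff by (auto intro!: exI[of _ c])

lemma bounded_measurable_bound:
  "bounded_measurable h \<Longrightarrow> \<exists>c. \<forall>x\<in>{0..sbar}. \<bar>h x\<bar> \<le> c"
  unfolding bounded_measurable_def bounded_iff by auto

lemma bounded_measurable_measurable:
  "bounded_measurable h \<Longrightarrow> (\<lambda>y. h (cap y)) \<in> borel_measurable borel"
  by (simp add: bounded_measurable_def)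

lemma bounded_measurable_cong:
  "(\<And>x. x \<in> {0..sbar} \<Longrightarrow> h x = h' x) \<Longrightarrow> bounded_measurable h \<longleftrightarrow> bounded_measurable h'"
  by (simp add: bounded_measurable_def cong: image_cong_simp)

lemma bounded_measurable_continuous:
  assumes "continuous_on {0..sbar} h"
  shows "bounded_measurable h"
proof -
  have "continuous_on UNIV (\<lambda>y. h (cap y))"
    by (rule continuous_on_compose2[OF assms]) (auto simp: cap_def intro!: continuous_intros sbar_pos[THEN less_imp_le])
  then have "(\<lambda>y. h (cap y)) \<in> borel_measurable borel" by (rule borel_measurable_continuous_onI)
  moreover have "bounded (h ` {0..sbar})"
    by (intro compact_imp_bounded compact_continuous_image assms) simp
  ultimately show ?thesis by (simp add: bounded_measurable_def)
qed

lemma integrable_gap: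
  assumes "bounded_measurable h"
  shows "integrable gap (\<lambda>a. h (cap (s + r * a)))"
proof -
  obtain c where c: "\<And>x. x \<in> {0..sbar} \<Longrightarrow> \<bar>h x\<bar> \<le> c" using bounded_measurable_bound[OF assms] by blast
  note [measurable] = bounded_measurable_measurable[OF assms]
  show ?thesis
    by (rule gap.integrable_const_bound[where B=c]) (use c in auto)
qed

lemma renewal_cong:
  "(\<And>x. x \<in> {0..sbar} \<Longrightarrow> h x = h' x) \<Longrightarrow> renewal h s = renewal h' s"
  by (simp add: renewal_def)

text \<open>
  Monotonicity, contraction and convexity estimates for \<open>renewal\<close> are all instances of this
  bound, because an additive error \<open>D\<close> is multiplied by the contraction factor.
\<close>

lemma renewal_le_combination:
  assumes h: "bounded_measurable h" "bounded_measurable h\<^sub>1" "bounded_measurable h\<^sub>2"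
    and le: "\<And>a. 0 \<le> a \<Longrightarrow>
      h (cap (z + r * a)) \<le> u * h\<^sub>1 (cap (x + r * a)) + v * h\<^sub>2 (cap (y + r * a)) + D"
  shows "renewal h z \<le> u * renewal h\<^sub>1 x + v * renewal h\<^sub>2 y + contraction_factor * D"
proof -
  have "(\<integral>a. h (cap (z + r * a)) \<partial>gap)
      \<le> (\<integral>a. u * h\<^sub>1 (cap (x + r * a)) + v * h\<^sub>2 (cap (y + r * a)) + D \<partial>gap)"
    by (intro integral_mono_AE Bochner_Integration.integrable_add integrable_mult_right
          integrable_gap h gap.integrable_const)
       (simp add: AE_gap_iff le)
  also have "\<dots> = u * (\<integral>a. h\<^sub>1 (cap (x + r * a)) \<partial>gap) + v * (\<integral>a. h\<^sub>2 (cap (y + r * a)) \<partial>gap) + D"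
    using gap.prob_space by (simp add: integrable_gap h)
  finally have "contraction_factor * (\<integral>a. h (cap (z + r * a)) \<partial>gap) \<le> contraction_factor * \<dots>"
    using contraction_factor_pos by (intro mult_left_mono) auto
  then show ?thesis by (simp add: renewal_def algebra_simps)
qed

lemma renewal_le:
  assumes "bounded_measurable h" "bounded_measurable h'"
    and "\<And>a. 0 \<le> a \<Longrightarrow> h (cap (s + r * a)) \<le> h' (cap (s' + r * a)) + D"
  shows "renewal h s \<le> renewal h' s' + contraction_factor * D"
  using renewal_le_combination[of h h' h' s 1 s' 0 s' D] assms by simp

lemma renewal_sbar:
  assumes "bounded_measurable h"
  shows "renewal h sbar = contraction_factor * h sbar"
proof -
  note [measurable] = bounded_measurable_measurable[OF assms]
  have "(\<integral>a. h (cap (sbar + r * a)) \<partial>gap) = (\<integral>a. h sbar \<partial>gap)"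
  proof (rule integral_cong_AE)
    show "AE a in gap. h (cap (sbar + r * a)) = h sbar"
      using r_pos by (simp add: AE_gap_iff)
  qed auto
  then show ?thesis using gap.prob_space by (simp add: renewal_def)
qed

text \<open>
  Substituting \<open>y = s + r * a\<close> moves the dependence on \<open>s\<close> out of the integrand, up to an
  exponential factor, and into the domain of integration.
\<close>

lemma renewal_eq_tail_integral:
  assumes h: "bounded_measurable h"
  shows "integrable lborel (\<lambda>y. indicator {s..} y * (Q / r * exp (- rate * y) * h (cap y)))" (is ?I)
    and "exp (- rate * s) * renewal h s =
      (\<integral>y. indicator {s..} y * (Q / r * exp (- rate * y) * h (cap y)) \<partial>lborel)" (is ?E)
proof -
  let ?f = "\<lambda>y. indicator {s..} y * (Q / r * exp (- rate * y) * h (cap y))"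
  let ?e = "exponential_density (Q + \<theta>)"
  note [measurable] = bounded_measurable_measurable[OF h]
  have nonneg: "0 \<le> ?e a" for a
    using Q_pos \<theta>_pos by (simp add: exponential_density_nonneg)
  have eq: "r * ?f (s + r * a) = exp (- rate * s) * contraction_factor * (?e a * h (cap (s + r * a)))" for a
  proof (cases "0 \<le> a")
    case True
    have "exp (- rate * (s + r * a)) = exp (- rate * s) * exp (- a * (Q + \<theta>))"
      using r_pos by (simp add: rate_def field_simps flip: exp_add)
    moreover have "(Q + \<theta>) * contraction_factor = Q"
      using Q_pos \<theta>_pos by (simp add: contraction_factor_def)
    moreover have "indicator {s..} (s + r * a) = (1::real)" using True r_pos by simp
    ultimately show ?thesis
      using True r_pos by (simp add: exponential_density_def mult_ac)
  next
    case False
    then have "indicator {s..} (s + r * a) = (0::real)"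
      using r_pos by (simp add: zero_le_mult_iff)
    then show ?thesis using False by (simp add: exponential_density_def)
  qed
  have int: "integrable lborel (\<lambda>a. ?e a * h (cap (s + r * a)))"
    using integrable_gap[OF h, of s] unfolding gap_def
    by (subst (asm) integrable_real_density) (auto simp: nonneg)
  have "integrable lborel (\<lambda>a. r * ?f (s + r * a))"
    unfolding eq by (intro integrable_mult_right int)
  then have "integrable lborel (\<lambda>a. ?f (s + r * a))"
    using r_pos by simp
  then show ?I
    using lborel_integrable_real_affine_iff[of r ?f s] r_pos by simp
  have "(\<integral>y. ?f y \<partial>lborel) = (\<integral>a. r * ?f (s + r * a) \<partial>lborel)"
    using r_pos by (subst lborel_integral_real_affine[where c=r and t=s]) auto
  also have "\<dots> = exp (- rate * s) * contraction_factor * (\<integral>a. ?e a * h (cap (s + r * a)) \<partial>lborel)"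
    unfolding eq by simp
  also have "(\<integral>a. ?e a * h (cap (s + r * a)) \<partial>lborel) = (\<integral>a. h (cap (s + r * a)) \<partial>gap)"
    unfolding gap_def by (subst integral_real_density) (auto simp: nonneg)
  finally show ?E by (simp add: renewal_def)
qed

lemma renewal_increment:
  assumes h: "bounded_measurable h" and st: "0 \<le> s" "s \<le> t" "t \<le> sbar"
  shows "((\<lambda>y. Q / r * exp (- rate * y) * h y) has_integral
    (exp (- rate * s) * renewal h s - exp (- rate * t) * renewal h t)) {s..t}"
proof -
  let ?\<phi> = "\<lambda>y. Q / r * exp (- rate * y) * h (cap y)"
  have "((\<lambda>y. indicator {s..} y * ?\<phi> y - indicator {t..} y * ?\<phi> y) has_integral
      (exp (- rate * s) * renewal h s - exp (- rate * t) * renewal h t)) UNIV"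
    unfolding renewal_eq_tail_integral(2)[OF h]
    by (intro has_integral_diff has_integral_integral_lborel renewal_eq_tail_integral(1) h)
  also have "(\<lambda>y. indicator {s..} y * ?\<phi> y - indicator {t..} y * ?\<phi> y) = (\<lambda>y. if y \<in> {s..<t} then ?\<phi> y else 0)"
    using st by (auto simp: fun_eq_iff split: split_indicator)
  finally have "(?\<phi> has_integral (exp (- rate * s) * renewal h s - exp (- rate * t) * renewal h t)) {s..<t}"
    by (simp only: has_integral_restrict_UNIV)
  then have "(?\<phi> has_integral (exp (- rate * s) * renewal h s - exp (- rate * t) * renewal h t)) {s..t}"
    by (rule has_integral_spike_set_eq[THEN iffD1, rotated 2])
       (auto intro: negligible_subset[of "{}"] negligible_subset[of "{t}"])
  then show ?thesis
    by (rule has_integral_eq[rotated]) (use st in auto)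
qed

text \<open>
  The increment of \<open>renewal h\<close> has two parts, an integral of \<open>h\<close> over \<open>[s, t]\<close> and the
  change of the exponential weight; each contributes \<open>Q / r * c\<close> to the constant, which depends on
  \<open>h\<close> only through its bound.
\<close>

lemma renewal_lipschitz:
  assumes h: "bounded_measurable h" and c: "\<And>x. x \<in> {0..sbar} \<Longrightarrow> \<bar>h x\<bar> \<le> c"
  shows "(2 * (Q / r) * c)-lipschitz_on {0..sbar} (renewal h)"
proof -
  have c0: "0 \<le> c" using c[of 0] sbar_pos by force
  have bound: "\<bar>renewal h t\<bar> \<le> contraction_factor * c" for t
  proof -
    have *: "0 \<le> c + h (cap y)" "h (cap y) \<le> c" for y
      using c[OF cap_in(1)[of y]] by (auto simp: abs_le_iff minus_le_iff)
    have "bounded_measurable (\<lambda>_. 0)" by (rule bounded_measurableI[of _ 0]) auto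
    then have "renewal h t \<le> renewal (\<lambda>_. 0) t + contraction_factor * c"
      "renewal (\<lambda>_. 0) t \<le> renewal h t + contraction_factor * c"
      using * by (auto intro!: renewal_le h simp: add.commute[of _ c])
    then show ?thesis by (simp add: renewal_def abs_le_iff)
  qed
  have *: "\<bar>renewal h s - renewal h t\<bar> \<le> 2 * (Q / r) * c * (t - s)" if st: "0 \<le> s" "s \<le> t" "t \<le> sbar" for s t
  proof -
    let ?I = "exp (- rate * s) * renewal h s - exp (- rate * t) * renewal h t"
    have "norm ?I \<le> (Q / r * exp (- rate * s) * c) * measure lborel (cbox s t)"
    proof (rule has_integral_bound)
      show "((\<lambda>y. Q / r * exp (- rate * y) * h y) has_integral ?I) (cbox s t)"
        using renewal_increment[OF h st] by simp
      fix y assume "y \<in> cbox s t"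
      then have y: "s \<le> y" "y \<in> {0..sbar}" using st by auto
      have "Q / r * exp (- rate * y) * \<bar>h y\<bar> \<le> Q / r * exp (- rate * s) * c"
        using c[OF y(2)] y(1) rate_pos Q_pos r_pos c0 by (intro mult_mono) auto
      then show "norm (Q / r * exp (- rate * y) * h y) \<le> Q / r * exp (- rate * s) * c"
        using Q_pos r_pos by (simp add: abs_mult)
    qed (use c0 Q_pos r_pos in auto)
    then have 1: "\<bar>?I\<bar> \<le> Q / r * exp (- rate * s) * c * (t - s)" using st by simp
    have "exp (rate * s) * \<bar>?I\<bar> \<le> exp (rate * s) * (Q / r * exp (- rate * s) * c * (t - s))"
      by (intro mult_left_mono 1) simp
    also have "\<dots> = (exp (rate * s) * exp (- rate * s)) * (Q / r * c * (t - s))" by (simp only: mult_ac)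
    also have "\<dots> = Q / r * c * (t - s)" by (simp flip: exp_add)
    finally have 2: "exp (rate * s) * \<bar>?I\<bar> \<le> Q / r * c * (t - s)" .
    have eq: "renewal h s - renewal h t = exp (rate * s) * ?I - (1 - exp (- rate * (t - s))) * renewal h t"
      by (simp add: algebra_simps exp_diff exp_minus exp_add divide_inverse)
    have "1 - exp (- rate * (t - s)) \<le> rate * (t - s)"
      using exp_ge_add_one_self[of "- rate * (t - s)"] by simp
    then have "(1 - exp (- rate * (t - s))) * \<bar>renewal h t\<bar> \<le> rate * (t - s) * (contraction_factor * c)"
      using bound[of t] rate_pos st by (intro mult_mono) auto
    also have "\<dots> = Q / r * c * (t - s)" by (simp flip: rate_contraction)
    finally have 3: "(1 - exp (- rate * (t - s))) * \<bar>renewal h t\<bar> \<le> Q / r * c * (t - s)" .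
    have "exp (- rate * (t - s)) \<le> 1" using rate_pos st by simp
    then have "\<bar>renewal h s - renewal h t\<bar> \<le> exp (rate * s) * \<bar>?I\<bar> + (1 - exp (- rate * (t - s))) * \<bar>renewal h t\<bar>"
      unfolding eq by (intro order_trans[OF abs_triangle_ineq4]) (simp add: abs_mult)
    with 2 3 show ?thesis by simp
  qed
  show ?thesis
  proof (rule lipschitz_onI)
    fix x y assume "x \<in> {0..sbar}" "y \<in> {0..sbar}"
    then show "dist (renewal h x) (renewal h y) \<le> 2 * (Q / r) * c * dist x y"
      using *[of x y] *[of y x] by (cases "x \<le> y") (auto simp: dist_real_def abs_minus_commute)
  qed (use Q_pos r_pos c0 in auto)
qed

lemma renewal_has_derivative:
  assumes h: "bounded_measurable h" and s: "s \<in> {0..sbar}"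
    and cont: "continuous (at s within {0..sbar}) h"
  shows "(renewal h has_real_derivative (rate * renewal h s - Q / r * h s)) (at s within {0..sbar})"
proof -
  let ?\<phi> = "\<lambda>y. Q / r * exp (- rate * y) * h y"
  have int: "?\<phi> integrable_on {0..sbar}"
    using renewal_increment[OF h, of 0 sbar] sbar_pos by (auto simp: integrable_on_def)
  have eq: "renewal h t = exp (rate * t) * (renewal h 0 - integral {0..t} ?\<phi>)" if "t \<in> {0..sbar}" for t
    using integral_unique[OF renewal_increment[OF h, of 0 t]] that by (simp add: exp_minus field_simps)
  have \<phi>_cont: "continuous (at s within {0..sbar}) ?\<phi>"
    by (intro continuous_intros cont)
  have D: "((\<lambda>u. integral {0..u} ?\<phi>) has_real_derivative ?\<phi> s) (at s within {0..sbar})"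
    using integral_has_vector_derivative_continuous_at[OF int, of s "{}"] s \<phi>_cont
    by (simp add: has_real_derivative_iff_has_vector_derivative)
  have E: "((\<lambda>t. exp (rate * t)) has_real_derivative rate * exp (rate * s)) (at s within {0..sbar})"
    by (auto intro!: derivative_eq_intros)
  have "((\<lambda>t. exp (rate * t) * (renewal h 0 - integral {0..t} ?\<phi>)) has_real_derivative
      (rate * renewal h s - Q / r * h s)) (at s within {0..sbar})"
    by (rule DERIV_cong[OF DERIV_mult[OF E DERIV_diff[OF DERIV_const D]]])
       (simp add: eq[OF s] exp_minus field_simps)
  then show ?thesis
    by (rule has_field_derivative_transform_within[OF _ zero_less_one s]) (rule eq[symmetric])
qed

lemma renewal_AE_derivative:
  assumes h: "bounded_measurable h" and V: "\<And>s. s \<in> {0..sbar} \<Longrightarrow> V s = renewal h s"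
    and diff: "V differentiable_on {0..sbar}"
  shows "AE s in lborel. s \<in> {0..sbar} \<longrightarrow>
    (V has_real_derivative (rate * V s - Q / r * h s)) (at s within {0..sbar})"
proof -
  obtain c where c: "\<And>x. x \<in> {0..sbar} \<Longrightarrow> \<bar>h x\<bar> \<le> c" using bounded_measurable_bound[OF h] by blast
  note [measurable] = bounded_measurable_measurable[OF h]
  obtain V' where V': "\<And>s. s \<in> {0..sbar} \<Longrightarrow> (V has_real_derivative V' s) (at s within {0..sbar})"
    using diff unfolding differentiable_on_def real_differentiable_def by metis
  let ?F = "\<lambda>s. exp (- rate * s) * V s"
  let ?\<phi> = "\<lambda>y. - (Q / r * exp (- rate * y) * h (cap y))"
  have "AE s in lborel. s \<in> {0..sbar} \<longrightarrow> exp (- rate * s) * (V' s - rate * V s) = ?\<phi> s"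
  proof (rule AE_deriv_eq_integrand)
    show "?\<phi> \<in> borel_measurable borel" by measurable
    show "\<bar>?\<phi> x\<bar> \<le> Q / r * 1 * c" if "x \<in> {0..sbar}" for x
    proof -
      have "Q / r * exp (- rate * x) * \<bar>h x\<bar> \<le> Q / r * 1 * c"
        using c[OF that] that rate_pos Q_pos r_pos by (intro mult_mono) auto
      then show ?thesis using that Q_pos r_pos by (simp add: abs_mult)
    qed
    show "(?\<phi> has_integral (?F y - ?F x)) {x..y}" if "0 \<le> x" "x \<le> y" "y \<le> sbar" for x y
    proof -
      have "((\<lambda>y. - (Q / r * exp (- rate * y) * h y)) has_integral (?F y - ?F x)) {x..y}"
        using has_integral_neg[OF renewal_increment[OF h that]] V that by simp
      then show ?thesis by (rule has_integral_eq[rotated]) (use that in auto)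
    qed
    show "(?F has_real_derivative (exp (- rate * x) * (V' x - rate * V x))) (at x within {0..sbar})"
      if "x \<in> {0..sbar}" for x
      by (rule derivative_eq_intros V'[OF that] refl)+ (simp add: algebra_simps)
  qed
  then show ?thesis
  proof eventually_elim
    case (elim s)
    show ?case
    proof
      assume s: "s \<in> {0..sbar}"
      then have "exp (- rate * s) * (V' s - rate * V s) = exp (- rate * s) * (- (Q / r * h s))"
        using elim by simp
      then have "V' s - rate * V s = - (Q / r * h s)" by (subst (asm) mult_left_cancel) auto
      then have "V' s = rate * V s - Q / r * h s" by simp
      with V'[OF s] show "(V has_real_derivative (rate * V s - Q / r * h s)) (at s within {0..sbar})"
        by simp
    qed
  qed
qed

text \<open>
  The weight of the tail integral is positive beyond \<open>s\<close>, so two ordered integrands with equal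
  integrals agree there.
\<close>

lemma renewal_AE_eq:
  assumes h: "bounded_measurable h" "bounded_measurable h'"
    and le: "\<And>y. s \<le> y \<Longrightarrow> h (cap y) \<le> h' (cap y)"
    and eq: "renewal h s = renewal h' s"
  shows "AE y in lborel. s \<le> y \<longrightarrow> h (cap y) = h' (cap y)"
proof -
  let ?f = "\<lambda>h y. indicator {s..} y * (Q / r * exp (- rate * y) * h (cap y))"
  note int = renewal_eq_tail_integral(1)[of _ s] and tail = renewal_eq_tail_integral(2)[of _ s]
  have "(\<integral>y. ?f h' y - ?f h y \<partial>lborel) = (\<integral>y. ?f h' y \<partial>lborel) - (\<integral>y. ?f h y \<partial>lborel)"
    by (intro Bochner_Integration.integral_diff int h)
  also have "\<dots> = 0" using eq by (simp only: tail[OF h(1), symmetric] tail[OF h(2), symmetric])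
  finally have "(\<integral>y. ?f h' y - ?f h y \<partial>lborel) = 0" .
  moreover have nonneg: "0 \<le> ?f h' y - ?f h y" for y
  proof (cases "s \<le> y")
    case True
    have "Q / r * exp (- rate * y) * h (cap y) \<le> Q / r * exp (- rate * y) * h' (cap y)"
      using le[OF True] Q_pos r_pos by (intro mult_left_mono) auto
    then show ?thesis using True by simp
  qed simp
  then have "AE y in lborel. 0 \<le> ?f h' y - ?f h y" by (rule AE_I2)
  note zero_iff = integral_nonneg_eq_0_iff_AE[OF
      Bochner_Integration.integrable_diff[OF int[OF h(2)] int[OF h(1)]] this]
  ultimately have "AE y in lborel. ?f h' y - ?f h y = 0" by (simp only: zero_iff)
  then show ?thesis
  proof eventually_elim
    case (elim y)
    then show ?case using Q_pos r_pos by (auto split: split_indicator_asm)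
  qed
qed

end

section \<open>Expected cost of a single shock\<close>

locale storage = charging r Q \<theta> sbar for r Q \<theta> sbar :: real +
  fixes B :: real and fW :: "real measure" and g :: "real \<Rightarrow> real" and L :: real
  assumes B_pos: "0 < B" and shock_distribution: "shock_distribution B fW"
    and g_strict_mono: "strict_mono_on {0..B} g" and g_0: "g 0 = 0"
    and g_lipschitz: "L-lipschitz_on {0..B} g"
    and g_mean: "(\<integral>w. g w \<partial>fW) > 0"
begin

sublocale fW: prob_space fW
  using shock_distribution by (simp add: shock_distribution_def)

lemma sets_fW [measurable_cong]: "sets fW = sets (restrict_space borel {0..B})"
  using shock_distribution by (simp add: shock_distribution_def)

lemma space_fW [simp]: "space fW = {0..B}"
  using sets_eq_imp_space_eq[OF sets_fW] by (simp add: space_restrict_space)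

lemma measurable_from_fW:
  assumes "f \<in> measurable N fW"
  shows "f \<in> borel_measurable N"
  using assms sets_fW by (subst (asm) measurable_cong_sets[OF refl sets_fW]) (simp add: measurable_restrict_space2_iff)

lemma fW_id_measurable [measurable]: "(\<lambda>w. w) \<in> borel_measurable fW"
  by (rule measurable_from_fW) simp

lemma fW_snd_measurable [measurable]: "snd \<in> borel_measurable (N \<Otimes>\<^sub>M fW)"
  by (rule measurable_from_fW) simp

lemma g_mono: "0 \<le> x \<Longrightarrow> x \<le> y \<Longrightarrow> y \<le> B \<Longrightarrow> g x \<le> g y"
  using strict_mono_on_leD[OF g_strict_mono, of x y] by auto

lemma g_less: "0 \<le> x \<Longrightarrow> x < y \<Longrightarrow> y \<le> B \<Longrightarrow> g x < g y"
  using strict_mono_onD[OF g_strict_mono, of x y] by auto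

lemma g_bounds: "x \<in> {0..B} \<Longrightarrow> 0 \<le> g x" "x \<in> {0..B} \<Longrightarrow> g x \<le> g B"
  using g_mono[of 0 x] g_mono[of x B] g_0 by auto

text \<open>
  Clamping the argument keeps the stage cost monotone, hence Borel measurable, on the whole line.
\<close>

definition g_ext :: "real \<Rightarrow> real" where
  "g_ext x = g (max 0 (min B x))"

lemma g_ext_eq [simp]: "x \<in> {0..B} \<Longrightarrow> g_ext x = g x"
  by (simp add: g_ext_def)

lemma g_ext_nonneg: "0 \<le> g_ext x"
  using g_bounds(1)[of "max 0 (min B x)"] B_pos by (simp add: g_ext_def)

lemma g_ext_le: "g_ext x \<le> g B"
  using g_bounds(2)[of "max 0 (min B x)"] B_pos by (simp add: g_ext_def)

lemma g_ext_measurable [measurable]: "g_ext \<in> borel_measurable borel"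
proof (rule borel_measurable_mono, rule monoI)
  show "g_ext x \<le> g_ext y" if "x \<le> y" for x y
    unfolding g_ext_def using that B_pos by (intro g_mono) auto
qed

lemma policyD:
  assumes "\<mu> \<in> policies sbar B" "s \<in> {0..sbar}" "w \<in> {0..B}"
  shows "0 \<le> \<mu> s w" "\<mu> s w \<le> s" "\<mu> s w \<le> w" "\<mu> s w \<in> {0..min s w}"
    "s - \<mu> s w \<in> {0..sbar}" "w - \<mu> s w \<in> {0..B}"
  using assms by (force simp: policies_def)+

text \<open>
  Policies are measurable only on \<open>[0, sbar] \<times> [0, B]\<close>. Clamping the level, and taking the
  shock from a space whose points lie in \<open>[0, B]\<close>, stays inside this rectangle.
\<close>

lemma policy_measurable:
  assumes "\<mu> \<in> policies sbar B" and [measurable]: "f \<in> borel_measurable N" "k \<in> measurable N fW"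
  shows "(\<lambda>x. \<mu> (cap (f x)) (k x)) \<in> borel_measurable N"
proof -
  note [measurable] = measurable_from_fW[OF assms(3)]
  have k: "k x \<in> {0..B}" if "x \<in> space N" for x
    using measurable_space[OF assms(3) that] by simp
  have "(\<lambda>x. (cap (f x), k x)) \<in> measurable N (restrict_space borel ({0..sbar} \<times> {0..B}))"
    by (intro measurable_restrict_space2) (use k in auto)
  moreover have "(\<lambda>(s, w). \<mu> s w) \<in> borel_measurable (restrict_space borel ({0..sbar} \<times> {0..B}))"
    using assms(1) by (simp add: policies_def)
  ultimately show ?thesis
    using measurable_compose[of "\<lambda>x. (cap (f x), k x)" N _ "\<lambda>(s, w). \<mu> s w" borel] by simp
qed

lemma policies_nonempty: "policies sbar B \<noteq> {}"
proof -
  have "(\<lambda>_ _. 0) \<in> policies sbar B" by (auto simp: policies_def)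
  then show ?thesis by blast
qed

definition stage_value :: "(real \<Rightarrow> real) \<Rightarrow> real \<Rightarrow> real \<Rightarrow> real \<Rightarrow> real" where
  "stage_value V x w u = g (w - u) + V (x - u)"

lemma stage_value_measurable:
  assumes \<mu>: "\<mu> \<in> policies sbar B" and V: "bounded_measurable V"
    and [measurable]: "f \<in> borel_measurable N" "k \<in> measurable N fW"
  shows "(\<lambda>x. stage_value V (cap (f x)) (k x) (\<mu> (cap (f x)) (k x))) \<in> borel_measurable N"
proof -
  note [measurable] = policy_measurable[OF \<mu>] measurable_from_fW[OF assms(4)]
  have V': "(\<lambda>x. V (cap (f' x))) \<in> borel_measurable N" if "f' \<in> borel_measurable N" for f'
    using measurable_compose[OF that bounded_measurable_measurable[OF V]] .
  have "(\<lambda>x. g_ext (k x - \<mu> (cap (f x)) (k x)) + V (cap (cap (f x) - \<mu> (cap (f x)) (k x)))) \<in> borel_measurable N"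
    by (intro borel_measurable_add V') measurable
  moreover have "g_ext (k x - \<mu> (cap (f x)) (k x)) + V (cap (cap (f x) - \<mu> (cap (f x)) (k x)))
      = stage_value V (cap (f x)) (k x) (\<mu> (cap (f x)) (k x))" if "x \<in> space N" for x
    using policyD(5,6)[OF \<mu>, of "cap (f x)" "k x"] measurable_space[OF assms(4) that]
    by (simp add: stage_value_def)
  ultimately show ?thesis by (simp cong: measurable_cong)
qed

lemma stage_value_bound:
  assumes \<mu>: "\<mu> \<in> policies sbar B" and V: "\<And>x. x \<in> {0..sbar} \<Longrightarrow> \<bar>V x\<bar> \<le> c"
    and "x \<in> {0..sbar}" "w \<in> {0..B}"
  shows "\<bar>stage_value V x w (\<mu> x w)\<bar> \<le> g B + c"
  using g_bounds[OF policyD(6)[OF \<mu> assms(3,4)]] V[OF policyD(5)[OF \<mu> assms(3,4)]]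
  by (simp add: stage_value_def)

lemma integrable_stage_value:
  assumes \<mu>: "\<mu> \<in> policies sbar B" and V: "bounded_measurable V" and x: "x \<in> {0..sbar}"
  shows "integrable fW (\<lambda>w. stage_value V x w (\<mu> x w))"
proof -
  obtain c where c: "\<And>x. x \<in> {0..sbar} \<Longrightarrow> \<bar>V x\<bar> \<le> c" using bounded_measurable_bound[OF V] by blast
  show ?thesis
  proof (rule fW.integrable_const_bound[where B="g B + c"])
    show "AE w in fW. norm (stage_value V x w (\<mu> x w)) \<le> g B + c"
      using stage_value_bound[OF \<mu> c x] by (intro AE_I2) simp
    show "(\<lambda>w. stage_value V x w (\<mu> x w)) \<in> borel_measurable fW"
      using stage_value_measurable[OF \<mu> V, of "\<lambda>_. x" fW "\<lambda>w. w"] x by simp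
  qed
qed

lemma shock_cost_eq: "shock_cost fW g V \<mu> x = (\<integral>w. stage_value V x w (\<mu> x w) \<partial>fW)"
  by (simp add: shock_cost_def stage_value_def)

lemma shock_cost_bound:
  assumes \<mu>: "\<mu> \<in> policies sbar B" and V: "bounded_measurable V"
    and c: "\<And>x. x \<in> {0..sbar} \<Longrightarrow> \<bar>V x\<bar> \<le> c" and x: "x \<in> {0..sbar}"
  shows "\<bar>shock_cost fW g V \<mu> x\<bar> \<le> g B + c"
proof -
  have "\<bar>shock_cost fW g V \<mu> x\<bar> \<le> (\<integral>w. \<bar>stage_value V x w (\<mu> x w)\<bar> \<partial>fW)"
    unfolding shock_cost_eq by (rule integral_abs_bound)
  also have "\<dots> \<le> (\<integral>w. g B + c \<partial>fW)"
    by (intro integral_mono integrable_abs integrable_stage_value \<mu> V x)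
       (use stage_value_bound[OF \<mu> c x] in auto)
  finally show ?thesis using fW.prob_space by simp
qed

lemma shock_cost_bounded_measurable:
  assumes \<mu>: "\<mu> \<in> policies sbar B" and V: "bounded_measurable V"
  shows "bounded_measurable (shock_cost fW g V \<mu>)"
proof -
  obtain c where c: "\<And>x. x \<in> {0..sbar} \<Longrightarrow> \<bar>V x\<bar> \<le> c" using bounded_measurable_bound[OF V] by blast
  show ?thesis
  proof (rule bounded_measurableI)
    show "(\<lambda>y. shock_cost fW g V \<mu> (cap y)) \<in> borel_measurable borel"
      unfolding shock_cost_eq
      using stage_value_measurable[OF \<mu> V, of fst "borel \<Otimes>\<^sub>M fW" snd]
      by (intro fW.borel_measurable_lebesgue_integral) (simp add: split_beta')
  qed (rule shock_cost_bound[OF \<mu> V c])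
qed

lemma shock_cost_mono:
  assumes \<mu>: "\<mu> \<in> policies sbar B" "\<mu>' \<in> policies sbar B" and V: "bounded_measurable V" "bounded_measurable V'"
    and x: "x \<in> {0..sbar}" "x' \<in> {0..sbar}"
    and le: "\<And>w. w \<in> {0..B} \<Longrightarrow> stage_value V x w (\<mu> x w) \<le> stage_value V' x' w (\<mu>' x' w) + D"
  shows "shock_cost fW g V \<mu> x \<le> shock_cost fW g V' \<mu>' x' + D"
proof -
  have "shock_cost fW g V \<mu> x \<le> (\<integral>w. stage_value V' x' w (\<mu>' x' w) + D \<partial>fW)"
    unfolding shock_cost_eq
    by (intro integral_mono Bochner_Integration.integrable_add integrable_stage_value \<mu> V x fW.integrable_const)
       (use le in auto)
  also have "\<dots> = shock_cost fW g V' \<mu>' x' + D"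
    using integrable_stage_value[OF \<mu>(2) V(2) x(2)] fW.prob_space by (simp add: shock_cost_eq)
  finally show ?thesis .
qed

text \<open>
  The feasible interval \<open>[0, min s w]\<close> varies with \<open>(s, w)\<close>; writing \<open>u = v * min s w\<close>
  with \<open>v\<close> in \<open>[0, 1]\<close> fixes it, so that a measurable minimiser can be selected.
\<close>

lemma exists_minimizing_policy:
  assumes V: "continuous_on {0..sbar} V"
  obtains \<mu> where "\<mu> \<in> policies sbar B"
    and "\<And>s w. s \<in> {0..sbar} \<Longrightarrow> w \<in> {0..B} \<Longrightarrow> minimizing_discharge g V s w (\<mu> s w)"
proof -
  let ?R = "{0..sbar} \<times> {0..B}"
  let ?N = "restrict_space borel ?R"
  let ?f = "\<lambda>p v. g (snd p - v * min (fst p) (snd p)) + V (fst p - v * min (fst p) (snd p))"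
  have g: "continuous_on {0..B} g" using g_lipschitz by (rule lipschitz_on_continuous_on)
  have range: "snd p - v * min (fst p) (snd p) \<in> {0..B}" "fst p - v * min (fst p) (snd p) \<in> {0..sbar}"
    "v * min (fst p) (snd p) \<in> {0..min (fst p) (snd p)}"
    if "p \<in> ?R" "v \<in> {0..1}" for p and v :: real
  proof -
    have "0 \<le> min (fst p) (snd p)" using that(1) by auto
    then have "0 \<le> v * min (fst p) (snd p)" "v * min (fst p) (snd p) \<le> min (fst p) (snd p)"
      using that(2) mult_left_le_one_le[of "min (fst p) (snd p)" v] by (simp_all del: min_le_iff_disj min.bounded_iff)
    then show "snd p - v * min (fst p) (snd p) \<in> {0..B}" "fst p - v * min (fst p) (snd p) \<in> {0..sbar}"
      "v * min (fst p) (snd p) \<in> {0..min (fst p) (snd p)}"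
      using that(1) by auto
  qed
  obtain v where v: "v \<in> borel_measurable ?N"
    and v_min: "\<And>p. p \<in> space ?N \<Longrightarrow> v p \<in> {0..1} \<and> (\<forall>v'\<in>{0..1}. ?f p (v p) \<le> ?f p v')"
  proof (rule measurable_argmin)
    show "(\<lambda>p. ?f p v) \<in> borel_measurable ?N" if "v \<in> {0..1}" for v
      by (intro borel_measurable_continuous_on_restrict continuous_intros
            continuous_on_compose2[OF g] continuous_on_compose2[OF V])
         (use range[OF _ that] in auto)
    show "continuous_on {0..1} (?f p)" if "p \<in> space ?N" for p
      by (intro continuous_intros continuous_on_compose2[OF g] continuous_on_compose2[OF V])
         (use range[of p] that in \<open>auto simp: space_restrict_space\<close>)
  qed blast
  define \<mu> where "\<mu> s w = v (s, w) * min s w" for s w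
  have v01: "v (s, w) \<in> {0..1}" if "s \<in> {0..sbar}" "w \<in> {0..B}" for s w
    using v_min[of "(s, w)"] that by (auto simp: space_restrict_space)
  have feasible: "\<mu> s w \<in> {0..min s w}" if "s \<in> {0..sbar}" "w \<in> {0..B}" for s w
    using range(3)[of "(s, w)", OF _ v01[OF that]] that by (simp add: \<mu>_def)
  show thesis
  proof (rule that)
    have "(\<lambda>p. v p * min (fst p) (snd p)) \<in> borel_measurable ?N"
      by (intro borel_measurable_times v measurable_restrict_space1 borel_measurable_continuous_onI
            continuous_intros)
    then show "\<mu> \<in> policies sbar B"
      using feasible by (auto simp: policies_def \<mu>_def split_beta')
    show "minimizing_discharge g V s w (\<mu> s w)" if s: "s \<in> {0..sbar}" and w: "w \<in> {0..B}" for s w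
      unfolding minimizing_discharge_def is_arg_min_linorder
    proof (intro conjI allI impI feasible s w)
      fix u assume u: "u \<in> {0..min s w}"
      \<comment> \<open>If \<open>min s w = 0\<close>, the only feasible discharge is 0 and any \<open>v\<close> represents it.\<close>
      let ?v = "if min s w = 0 then 0 else u / min s w"
      have "?v \<in> {0..1}" "?v * min s w = u"
        using u s w by (auto simp: divide_le_eq_1)
      moreover have "?f (s, w) (v (s, w)) \<le> ?f (s, w) v'" if "v' \<in> {0..1}" for v'
        using v_min[of "(s, w)"] that s w by (auto simp: space_restrict_space)
      ultimately have "?f (s, w) (v (s, w)) \<le> ?f (s, w) ?v" by blast
      then show "g (w - \<mu> s w) + V (s - \<mu> s w) \<le> g (w - u) + V (s - u)"
        using \<open>?v * min s w = u\<close> by (simp add: \<mu>_def)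
    qed
  qed
qed

lemma minimizing_discharge_iff:
  "minimizing_discharge g V s w u \<longleftrightarrow>
     u \<in> {0..min s w} \<and> (\<forall>v\<in>{0..min s w}. stage_value V s w u \<le> stage_value V s w v)"
  by (auto simp: minimizing_discharge_def is_arg_min_linorder stage_value_def)

lemma min_shock_cost_eq:
  assumes \<mu>: "\<And>w. w \<in> {0..B} \<Longrightarrow> minimizing_discharge g V s w (\<mu> s w)"
  shows "min_shock_cost fW g V s = shock_cost fW g V \<mu> s"
proof -
  have "(INF u\<in>{0..min s w}. stage_value V s w u) = stage_value V s w (\<mu> s w)" if "w \<in> {0..B}" for w
    using \<mu>[OF that] unfolding minimizing_discharge_iff by (intro cInf_eq_minimum) auto
  then show ?thesis
    unfolding min_shock_cost_def shock_cost_def stage_value_def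
    by (intro Bochner_Integration.integral_cong) auto
qed

end

section \<open>Value function and Hamilton--Jacobi--Bellman equation\<close>

text \<open>
  All statements about the value function follow from the renewal equations of the costs of the
  policies, together with a common bound. The probability space on which the costs are defined is
  therefore left out here.
\<close>

locale storage_costs = storage r Q \<theta> sbar B fW g L
  for r Q \<theta> sbar B :: real and fW :: "real measure" and g :: "real \<Rightarrow> real" and L :: real +
  fixes Cpol :: "(real \<Rightarrow> real \<Rightarrow> real) \<Rightarrow> real \<Rightarrow> real" and c :: real
  assumes Cpol_bounded_measurable: "\<mu> \<in> policies sbar B \<Longrightarrow> bounded_measurable (Cpol \<mu>)"
    and Cpol_bounds: "\<mu> \<in> policies sbar B \<Longrightarrow> s \<in> {0..sbar} \<Longrightarrow> Cpol \<mu> s \<in> {0..c}"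
    and Cpol_renewal: "\<mu> \<in> policies sbar B \<Longrightarrow> s \<in> {0..sbar} \<Longrightarrow>
      Cpol \<mu> s = renewal (shock_cost fW g (Cpol \<mu>) \<mu>) s"
begin

definition C :: "real \<Rightarrow> real" where
  "C s = (INF \<mu>\<in>policies sbar B. Cpol \<mu> s)"

lemma C_le:
  assumes "\<mu> \<in> policies sbar B" "s \<in> {0..sbar}"
  shows "C s \<le> Cpol \<mu> s"
  unfolding C_def using Cpol_bounds assms
  by (intro cINF_lower bdd_belowI2[where m=0]) auto

lemma C_greatest: "(\<And>\<mu>. \<mu> \<in> policies sbar B \<Longrightarrow> x \<le> Cpol \<mu> s) \<Longrightarrow> x \<le> C s"
  unfolding C_def by (rule cINF_greatest[OF policies_nonempty])

lemma C_bounds: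
  assumes "s \<in> {0..sbar}"
  shows "0 \<le> C s" "C s \<le> c"
proof -
  show "0 \<le> C s" using Cpol_bounds assms by (intro C_greatest) auto
  obtain \<mu> where "\<mu> \<in> policies sbar B" using policies_nonempty by blast
  then show "C s \<le> c" using C_le[of \<mu> s] Cpol_bounds[of \<mu> s] assms by auto
qed

definition C_slope :: real where "C_slope = 2 * (Q / r) * (g B + c)"

text \<open>
  The costs of all policies share a Lipschitz constant, because they are \<open>renewal\<close> of functions with
  a common bound; the infimum inherits it. This gives continuity of \<open>C\<close> before anything is known
  about optimal policies.
\<close>

lemma C_lipschitz: "C_slope-lipschitz_on {0..sbar} C"
proof (rule lipschitz_onI)
  have Cpol_lip: "C_slope-lipschitz_on {0..sbar} (Cpol \<mu>)" if \<mu>: "\<mu> \<in> policies sbar B" for \<mu>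
  proof -
    have "C_slope-lipschitz_on {0..sbar} (renewal (shock_cost fW g (Cpol \<mu>) \<mu>))"
      unfolding C_slope_def
    proof (rule renewal_lipschitz)
      show "\<bar>shock_cost fW g (Cpol \<mu>) \<mu> x\<bar> \<le> g B + c" if "x \<in> {0..sbar}" for x
        using Cpol_bounds[OF \<mu>] by (intro shock_cost_bound \<mu> Cpol_bounded_measurable that) auto
    qed (intro shock_cost_bounded_measurable \<mu> Cpol_bounded_measurable)
    then show ?thesis
      by (rule lipschitz_on_transform) (simp add: Cpol_renewal[OF \<mu>])
  qed
  have le: "C x \<le> C y + C_slope * dist x y" if xy: "x \<in> {0..sbar}" "y \<in> {0..sbar}" for x y
  proof -
    have "C x - C_slope * dist x y \<le> C y"
    proof (rule C_greatest)
      fix \<mu> assume \<mu>: "\<mu> \<in> policies sbar B"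
      show "C x - C_slope * dist x y \<le> Cpol \<mu> y"
        using C_le[OF \<mu> xy(1)] lipschitz_onD[OF Cpol_lip[OF \<mu>] xy] by (simp add: dist_real_def)
    qed
    then show ?thesis by simp
  qed
  show "dist (C x) (C y) \<le> C_slope * dist x y" if "x \<in> {0..sbar}" "y \<in> {0..sbar}" for x y
    using le[OF that] le[OF that(2,1)] by (simp add: dist_real_def abs_minus_commute abs_le_iff)
  have "0 \<le> c" using C_bounds[of 0] sbar_pos by simp
  then show "0 \<le> C_slope" using g_bounds(1)[of B] B_pos Q_pos r_pos by (simp add: C_slope_def)
qed

lemma C_bounded_measurable: "bounded_measurable C"
  by (intro bounded_measurable_continuous lipschitz_on_continuous_on[OF C_lipschitz])

text \<open>
  Its choice of \<open>u\<close> minimises the current cost plus \<open>C\<close> at the resulting level. It turns out to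
  be optimal.
\<close>

definition greedy :: "real \<Rightarrow> real \<Rightarrow> real" where
  "greedy = (SOME \<mu>. \<mu> \<in> policies sbar B \<and>
     (\<forall>s\<in>{0..sbar}. \<forall>w\<in>{0..B}. minimizing_discharge g C s w (\<mu> s w)))"

lemma greedy: "greedy \<in> policies sbar B"
  and greedy_minimizing: "\<And>s w. s \<in> {0..sbar} \<Longrightarrow> w \<in> {0..B} \<Longrightarrow> minimizing_discharge g C s w (greedy s w)"
proof -
  have "\<exists>\<mu>. \<mu> \<in> policies sbar B \<and> (\<forall>s\<in>{0..sbar}. \<forall>w\<in>{0..B}. minimizing_discharge g C s w (\<mu> s w))"
    using exists_minimizing_policy[OF lipschitz_on_continuous_on[OF C_lipschitz]] by metis
  from someI_ex[OF this] show "greedy \<in> policies sbar B"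
    "\<And>s w. s \<in> {0..sbar} \<Longrightarrow> w \<in> {0..B} \<Longrightarrow> minimizing_discharge g C s w (greedy s w)"
    unfolding greedy_def by blast+
qed

abbreviation U :: "real \<Rightarrow> real" where
  "U \<equiv> min_shock_cost fW g C"

text \<open>
  The minimum over the feasible discharges, represented by the greedy one; in this form it is measurable
  in the shock.
\<close>

abbreviation m :: "real \<Rightarrow> real \<Rightarrow> real" where
  "m s w \<equiv> stage_value C s w (greedy s w)"

lemma m_le:
  assumes "s \<in> {0..sbar}" "w \<in> {0..B}" "0 \<le> u" "u \<le> s" "u \<le> w"
  shows "m s w \<le> stage_value C s w u"
  using greedy_minimizing[OF assms(1,2)] assms(3-) by (simp add: minimizing_discharge_iff)

lemma U_eq: "s \<in> {0..sbar} \<Longrightarrow> U s = shock_cost fW g C greedy s"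
  by (intro min_shock_cost_eq greedy_minimizing)

lemma U_bounded_measurable: "bounded_measurable U"
  using shock_cost_bounded_measurable[OF greedy C_bounded_measurable]
  by (subst bounded_measurable_cong[OF U_eq])

lemma U_le_shock_cost:
  assumes \<mu>: "\<mu> \<in> policies sbar B" and x: "x \<in> {0..sbar}"
  shows "U x \<le> shock_cost fW g (Cpol \<mu>) \<mu> x"
proof -
  have "shock_cost fW g C greedy x \<le> shock_cost fW g (Cpol \<mu>) \<mu> x + 0"
  proof (intro shock_cost_mono greedy \<mu> C_bounded_measurable Cpol_bounded_measurable x)
    fix w assume w: "w \<in> {0..B}"
    have "m x w \<le> stage_value C x w (\<mu> x w)"
      using policyD[OF \<mu> x w] by (intro m_le x w) auto
    also have "\<dots> \<le> stage_value (Cpol \<mu>) x w (\<mu> x w)"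
      using C_le[OF \<mu> policyD(5)[OF \<mu> x w]] by (simp add: stage_value_def)
    finally show "m x w \<le> stage_value (Cpol \<mu>) x w (\<mu> x w) + 0" by simp
  qed
  then show ?thesis by (simp add: U_eq[OF x])
qed

text \<open>
  Half of the optimality equation: whatever a policy does at the first shock, it does not beat the best
  decision, and it does not beat \<open>C\<close> afterwards.
\<close>

lemma renewal_U_le_C:
  assumes s: "s \<in> {0..sbar}"
  shows "renewal U s \<le> C s"
proof (rule C_greatest)
  fix \<mu> assume \<mu>: "\<mu> \<in> policies sbar B"
  have "renewal U s \<le> renewal (shock_cost fW g (Cpol \<mu>) \<mu>) s + contraction_factor * 0"
    by (intro renewal_le U_bounded_measurable shock_cost_bounded_measurable \<mu> Cpol_bounded_measurable)
       (simp add: U_le_shock_cost \<mu>)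
  then show "renewal U s \<le> Cpol \<mu> s" by (simp add: Cpol_renewal[OF \<mu> s])
qed

text \<open>
  The greedy policy is optimal at the first shock if the future costs \<open>C\<close>. Its true future cost
  exceeds \<open>C\<close> by at most the supremum \<open>D\<close> of the excess, so the excess is at most
  \<open>contraction_factor * D\<close> by \<open>renewal_U_le_C\<close>, hence zero.
\<close>

lemma C_eq_Cpol_greedy:
  assumes s: "s \<in> {0..sbar}"
  shows "Cpol greedy s = C s"
proof -
  have "Cpol greedy s - C s \<le> 0"
  proof (rule nonpos_of_contraction[where S="{0..sbar}", OF _ contraction_factor_less_1 _ s])
    show "bdd_above ((\<lambda>s. Cpol greedy s - C s) ` {0..sbar})"
      using Cpol_bounds[OF greedy] C_bounds(1) by (intro bdd_aboveI2[where M=c]) force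
    fix D x assume D: "\<And>x. x \<in> {0..sbar} \<Longrightarrow> Cpol greedy x - C x \<le> D" and x: "x \<in> {0..sbar}"
    have "shock_cost fW g (Cpol greedy) greedy y \<le> U y + D" if y: "y \<in> {0..sbar}" for y
      unfolding U_eq[OF y]
    proof (intro shock_cost_mono greedy C_bounded_measurable Cpol_bounded_measurable y)
      fix w assume "w \<in> {0..B}"
      then show "stage_value (Cpol greedy) y w (greedy y w) \<le> m y w + D"
        using D[OF policyD(5)[OF greedy y, of w]] by (simp add: stage_value_def)
    qed
    then have "renewal (shock_cost fW g (Cpol greedy) greedy) x \<le> renewal U x + contraction_factor * D"
      by (intro renewal_le U_bounded_measurable shock_cost_bounded_measurable greedy Cpol_bounded_measurable) simp
    then show "Cpol greedy x - C x \<le> contraction_factor * D"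
      using renewal_U_le_C[OF x] Cpol_renewal[OF greedy x] by simp
  qed
  then show ?thesis using C_le[OF greedy s] by simp
qed

lemma C_renewal:
  assumes s: "s \<in> {0..sbar}"
  shows "C s = renewal U s"
proof -
  have "C s = renewal (shock_cost fW g (Cpol greedy) greedy) s"
    using C_eq_Cpol_greedy[OF s] Cpol_renewal[OF greedy s] by simp
  also have "\<dots> = renewal U s"
  proof (rule renewal_cong)
    fix x assume x: "x \<in> {0..sbar}"
    have "stage_value (Cpol greedy) x w (greedy x w) = m x w" if "w \<in> {0..B}" for w
      using C_eq_Cpol_greedy[OF policyD(5)[OF greedy x that]] by (simp add: stage_value_def)
    then show "shock_cost fW g (Cpol greedy) greedy x = U x"
      unfolding U_eq[OF x] shock_cost_eq by (intro Bochner_Integration.integral_cong) auto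
  qed
  finally show ?thesis .
qed

text \<open>
  More storage admits the same discharges. If larger levels were worse by at most \<open>D\<close>, copying the
  discharge of the smaller level shows that they are worse by at most \<open>contraction_factor * D\<close>.
\<close>

lemma C_antimono:
  assumes "0 \<le> x" "x \<le> y" "y \<le> sbar"
  shows "C y \<le> C x"
proof -
  let ?S = "{(x, y). 0 \<le> x \<and> x \<le> y \<and> y \<le> sbar}"
  have "(\<lambda>(x, y). C y - C x) (x, y) \<le> 0"
  proof (rule nonpos_of_contraction[where S="?S", OF _ contraction_factor_less_1])
    show "bdd_above ((\<lambda>(x, y). C y - C x) ` ?S)"
    proof (rule bdd_aboveI2[where M=c], clarify)
      fix x y assume "0 \<le> x" "x \<le> y" "y \<le> sbar"
      then show "C y - C x \<le> c" using C_bounds[of x] C_bounds[of y] by auto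
    qed
    show "(x, y) \<in> ?S" using assms by simp
    fix D and p :: "real \<times> real"
    assume D: "\<And>p. p \<in> ?S \<Longrightarrow> (\<lambda>(x, y). C y - C x) p \<le> D" and p: "p \<in> ?S"
    obtain x y where p_eq: "p = (x, y)" and xy: "0 \<le> x" "x \<le> y" "y \<le> sbar" using p by auto
    have "U y' \<le> U x' + D" if *: "0 \<le> x'" "x' \<le> y'" "y' \<le> sbar" for x' y'
    proof -
      have x': "x' \<in> {0..sbar}" and y': "y' \<in> {0..sbar}" using * by auto
      show ?thesis
        unfolding U_eq[OF x'] U_eq[OF y']
      proof (intro shock_cost_mono greedy C_bounded_measurable x' y')
        fix w assume w: "w \<in> {0..B}"
        note u = policyD[OF greedy x' w]
        have "m y' w \<le> stage_value C y' w (greedy x' w)"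
          using u * by (intro m_le y' w) auto
        also have "\<dots> \<le> m x' w + D"
          using D[of "(x' - greedy x' w, y' - greedy x' w)"] u * by (simp add: stage_value_def)
        finally show "m y' w \<le> m x' w + D" .
      qed
    qed
    then have "renewal U y \<le> renewal U x + contraction_factor * D"
      using xy r_pos by (intro renewal_le U_bounded_measurable) (simp add: cap_mono)
    then show "(\<lambda>(x, y). C y - C x) p \<le> contraction_factor * D"
      using xy by (simp add: p_eq C_renewal)
  qed
  then show ?thesis by simp
qed

lemma U_antimono:
  assumes "0 \<le> x" "x \<le> y" "y \<le> sbar"
  shows "U y \<le> U x"
proof -
  have x: "x \<in> {0..sbar}" and y: "y \<in> {0..sbar}" using assms by auto
  have "shock_cost fW g C greedy y \<le> shock_cost fW g C greedy x + 0"
  proof (intro shock_cost_mono greedy C_bounded_measurable x y)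
    fix w assume w: "w \<in> {0..B}"
    note u = policyD[OF greedy x w]
    have "m y w \<le> stage_value C y w (greedy x w)"
      using u assms by (intro m_le y w) auto
    also have "\<dots> \<le> m x w"
      using C_antimono[of "x - greedy x w" "y - greedy x w"] u assms by (simp add: stage_value_def)
    finally show "m y w \<le> m x w + 0" by simp
  qed
  then show ?thesis by (simp add: U_eq[OF x] U_eq[OF y])
qed

text \<open>
  From the smaller level the discharge of the larger one is imitated, reduced by the difference of
  the levels to keep it feasible.
\<close>

lemma U_lipschitz: "(L + C_slope)-lipschitz_on {0..sbar} U"
proof (rule lipschitz_onI)
  have LK: "0 \<le> L" "0 \<le> C_slope" using g_lipschitz C_lipschitz by (auto dest: lipschitz_on_nonneg)
  then show "0 \<le> L + C_slope" by simp
  have *: "\<bar>U x - U y\<bar> \<le> (L + C_slope) * (y - x)" if xy: "0 \<le> x" "x \<le> y" "y \<le> sbar" for x y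
  proof -
    have x: "x \<in> {0..sbar}" and y: "y \<in> {0..sbar}" using xy by auto
    have "shock_cost fW g C greedy x \<le> shock_cost fW g C greedy y + (L + C_slope) * (y - x)"
    proof (intro shock_cost_mono greedy C_bounded_measurable x y)
      fix w assume w: "w \<in> {0..B}"
      note u = policyD[OF greedy y w]
      let ?u = "greedy y w"
      \<comment> \<open>As \<open>?u \<le> y\<close>, lowering \<open>?u\<close> by \<open>y - x\<close>, but not below 0, gives a feasible discharge at \<open>x\<close>.\<close>
      let ?v = "max 0 (?u - (y - x))"
      have v: "0 \<le> ?v" "?v \<le> x" "?v \<le> w" "\<bar>?v - ?u\<bar> \<le> y - x" "\<bar>(x - ?v) - (y - ?u)\<bar> \<le> y - x"
        using u xy by auto
      have "\<bar>g (w - ?v) - g (w - ?u)\<bar> \<le> L * \<bar>(w - ?v) - (w - ?u)\<bar>"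
        using lipschitz_onD[OF g_lipschitz, of "w - ?v" "w - ?u"] u v w by (auto simp: dist_real_def)
      also have "\<dots> \<le> L * (y - x)" using v(4) LK by (intro mult_left_mono) auto
      finally have 1: "g (w - ?v) \<le> g (w - ?u) + L * (y - x)" by simp
      have "\<bar>C (x - ?v) - C (y - ?u)\<bar> \<le> C_slope * \<bar>(x - ?v) - (y - ?u)\<bar>"
        using lipschitz_onD[OF C_lipschitz, of "x - ?v" "y - ?u"] u v x by (auto simp: dist_real_def)
      also have "\<dots> \<le> C_slope * (y - x)" using v(5) LK by (intro mult_left_mono) auto
      finally have 2: "C (x - ?v) \<le> C (y - ?u) + C_slope * (y - x)" by simp
      have "m x w \<le> stage_value C x w ?v" by (intro m_le x w v)
      then show "m x w \<le> m y w + (L + C_slope) * (y - x)"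
        using 1 2 by (simp add: stage_value_def distrib_right)
    qed
    then have "U x \<le> U y + (L + C_slope) * (y - x)" by (simp add: U_eq[OF x] U_eq[OF y])
    then show ?thesis using U_antimono[OF xy] by simp
  qed
  show "dist (U x) (U y) \<le> (L + C_slope) * dist x y" if "x \<in> {0..sbar}" "y \<in> {0..sbar}" for x y
    using *[of x y] *[of y x] that by (cases "x \<le> y") (auto simp: dist_real_def abs_minus_commute)
qed

lemma C_has_derivative:
  assumes s: "s \<in> {0..sbar}"
  shows "(C has_real_derivative (rate * C s - Q / r * U s)) (at s within {0..sbar})"
proof -
  have "continuous (at s within {0..sbar}) U"
    using lipschitz_on_continuous_on[OF U_lipschitz] s by (simp add: continuous_on_eq_continuous_within)
  then have "(renewal U has_real_derivative (rate * renewal U s - Q / r * U s)) (at s within {0..sbar})"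
    by (rule renewal_has_derivative[OF U_bounded_measurable s])
  then show ?thesis
    unfolding C_renewal[OF s, symmetric]
    by (rule has_field_derivative_transform_within[OF _ zero_less_one s]) (simp add: C_renewal)
qed

lemma C_sbar: "C sbar = contraction_factor * U sbar"
  using C_renewal[of sbar] renewal_sbar[OF U_bounded_measurable] sbar_pos by simp

text \<open>
  Convex combinations of feasible discharges are feasible for the convex combination of the levels,
  so the convexity defect of \<open>U\<close> is at most that of \<open>C\<close>. Charging is a concave function of the
  level, and \<open>U\<close> is decreasing; therefore \<open>renewal\<close> shrinks the defect by the contraction
  factor.
\<close>

lemma C_convex:
  assumes g: "convex_on {0..B} g"
  shows "convex_on {0..sbar} C"
proof -
  let ?S = "{(x, y, u, v). x \<in> {0..sbar} \<and> y \<in> {0..sbar} \<and> 0 \<le> u \<and> 0 \<le> v \<and> u + v = 1}"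
  let ?f = "\<lambda>(x, y, u, v). C (u * x + v * y) - (u * C x + v * C y)"
  have mem: "u * x + v * y \<in> {0..b}" if "x \<in> {0..b}" "y \<in> {0..b}" "0 \<le> u" "0 \<le> v" "u + v = 1" for x y u v b :: real
    using convexD[OF convex_real_interval(5)[of 0 b] that] by simp
  have "?f p \<le> 0" if "p \<in> ?S" for p
  proof (rule nonpos_of_contraction[where S="?S", OF _ contraction_factor_less_1 _ that])
    show "bdd_above (?f ` ?S)"
    proof (rule bdd_aboveI2[where M=c], clarify)
      fix x y u v :: real assume *: "x \<in> {0..sbar}" "y \<in> {0..sbar}" "0 \<le> u" "0 \<le> v" "u + v = 1"
      have "0 \<le> u * C x + v * C y" using * C_bounds by simp
      then show "C (u * x + v * y) - (u * C x + v * C y) \<le> c"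
        using C_bounds(2)[OF mem[OF *]] by simp
    qed
    fix D and p :: "real \<times> real \<times> real \<times> real"
    assume D: "\<And>p. p \<in> ?S \<Longrightarrow> ?f p \<le> D" and p: "p \<in> ?S"
    obtain x y u v where p_eq: "p = (x, y, u, v)" and xy: "x \<in> {0..sbar}" "y \<in> {0..sbar}"
      and uv: "0 \<le> u" "0 \<le> v" "u + v = 1"
      using p by auto
    have U_le: "U (u * x' + v * y') \<le> u * U x' + v * U y' + D"
      if x': "x' \<in> {0..sbar}" and y': "y' \<in> {0..sbar}" for x' y'
    proof -
      let ?z = "u * x' + v * y'"
      have z: "?z \<in> {0..sbar}" by (rule mem[OF x' y' uv])
      have "(\<integral>w. m ?z w \<partial>fW) \<le> (\<integral>w. u * m x' w + v * m y' w + D \<partial>fW)"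
      proof (intro integral_mono Bochner_Integration.integrable_add integrable_mult_right
            integrable_stage_value greedy C_bounded_measurable x' y' z fW.integrable_const)
        fix w assume "w \<in> space fW"
        then have w: "w \<in> {0..B}" by simp
        let ?a = "greedy x' w" and ?b = "greedy y' w"
        note a = policyD[OF greedy x' w] and b = policyD[OF greedy y' w]
        let ?d = "u * ?a + v * ?b"
        have d: "0 \<le> ?d" "?d \<le> ?z" "?d \<le> u * w + v * w"
          using uv a b by (auto intro!: add_mono mult_left_mono)
        have w_eq: "u * w + v * w = w" using uv by (simp flip: distrib_right)
        have "m ?z w \<le> stage_value C ?z w ?d"
          using d w_eq by (intro m_le z w) auto
        moreover have "w - ?d = u * (w - ?a) + v * (w - ?b)" using w_eq by (simp add: algebra_simps)
        then have "g (w - ?d) \<le> u * g (w - ?a) + v * g (w - ?b)"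
          using g uv a(6) b(6) unfolding convex_on_def by simp
        moreover have "?z - ?d = u * (x' - ?a) + v * (y' - ?b)" by (simp add: algebra_simps)
        then have "C (?z - ?d) \<le> u * C (x' - ?a) + v * C (y' - ?b) + D"
          using D[of "(x' - ?a, y' - ?b, u, v)"] uv a(5) b(5) by simp
        ultimately show "m ?z w \<le> u * m x' w + v * m y' w + D"
          by (simp add: stage_value_def distrib_left)
      qed
      also have "\<dots> = u * (\<integral>w. m x' w \<partial>fW) + v * (\<integral>w. m y' w \<partial>fW) + D"
        using integrable_stage_value[OF greedy C_bounded_measurable x']
          integrable_stage_value[OF greedy C_bounded_measurable y'] fW.prob_space by simp
      finally show ?thesis by (simp add: U_eq[OF x'] U_eq[OF y'] U_eq[OF z] shock_cost_eq)
    qed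
    have "renewal U (u * x + v * y) \<le> u * renewal U x + v * renewal U y + contraction_factor * D"
    proof (intro renewal_le_combination U_bounded_measurable)
      fix a :: real assume a: "0 \<le> a"
      let ?x = "cap (x + r * a)" and ?y = "cap (y + r * a)" and ?z = "cap (u * x + v * y + r * a)"
      have "u * ?x + v * ?y \<le> u * (x + r * a) + v * (y + r * a)"
        using uv xy a r_pos by (intro add_mono mult_left_mono) (auto simp: cap_def)
      also have "\<dots> = u * x + v * y + (u + v) * (r * a)" by (simp add: algebra_simps)
      finally have "u * ?x + v * ?y \<le> u * x + v * y + r * a" using uv by simp
      moreover have mm: "u * ?x + v * ?y \<in> {0..sbar}" by (intro mem uv cap_in)
      ultimately have "u * ?x + v * ?y \<le> ?z" by (auto simp: cap_def[of "u * x + v * y + r * a"])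
      then have "U ?z \<le> U (u * ?x + v * ?y)" using mm by (intro U_antimono) auto
      also have "\<dots> \<le> u * U ?x + v * U ?y + D" by (intro U_le cap_in)
      finally show "U ?z \<le> u * U ?x + v * U ?y + D" .
    qed
    then show "?f p \<le> contraction_factor * D"
      using xy mem[OF xy uv] by (simp add: p_eq C_renewal)
  qed
  then have *: "C (u * x + v * y) \<le> u * C x + v * C y"
    if "x \<in> {0..sbar}" "y \<in> {0..sbar}" "0 \<le> u" "0 \<le> v" "u + v = 1" for x y u v
    using that by (force simp: Ball_def)
  show ?thesis unfolding convex_on_def using * by auto
qed

text \<open>
  Where \<open>C\<close> is flat its derivative vanishes, so \<open>C x = contraction_factor * U x\<close>: charging
  until the next arrival has no benefit. As \<open>U\<close> is decreasing, \<open>U\<close> must agree with \<open>U x\<close> at almost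
  all higher levels. The capacity \<open>sbar\<close> is not an exceptional level, since all sufficiently long
  waiting times lead to it.
\<close>

lemma C_flat:
  assumes xy: "0 \<le> x" "x < y" "y \<le> sbar" and eq: "C x = C y"
  shows "C x = C sbar" "U x = U sbar"
proof -
  have x: "x \<in> {0..sbar}" using xy by auto
  have const: "C z = C x" if "z \<in> {x..y}" for z
    using C_antimono[of x z] C_antimono[of z y] xy that eq by auto
  have "(C has_real_derivative (rate * C x - Q / r * U x)) (at x within {x..y})"
    by (rule DERIV_subset[OF C_has_derivative[OF x]]) (use xy in auto)
  moreover have "(C has_real_derivative 0) (at x within {x..y})"
    by (rule has_field_derivative_transform_within[OF DERIV_const[of "C x"] zero_less_one])
       (use xy in simp, rule const[symmetric])
  ultimately have "rate * C x - Q / r * U x = 0"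
    using xy by (intro vector_derivative_unique_within_closed_interval[of x y x C])
      (auto simp: has_real_derivative_iff_has_vector_derivative)
  then have "rate * C x = rate * (contraction_factor * U x)"
    by (simp flip: rate_contraction)
  then have 1: "C x = contraction_factor * U x" using rate_pos by simp
  have AE: "AE y in lborel. x \<le> y \<longrightarrow> U (cap y) = U x"
  proof (rule renewal_AE_eq)
    show "U (cap y) \<le> U x" if "x \<le> y" for y
      using that xy by (intro U_antimono) (auto simp: cap_def)
    have "renewal (\<lambda>_. U x) x = contraction_factor * U x"
      using gap.prob_space by (simp add: renewal_def)
    then show "renewal U x = renewal (\<lambda>_. U x) x" using 1 C_renewal[OF x] by simp
    show "bounded_measurable (\<lambda>_. U x)" by (rule bounded_measurable_continuous) simp
  qed (rule U_bounded_measurable)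
  show U: "U x = U sbar"
  proof (rule ccontr)
    assume "U x \<noteq> U sbar"
    have "AE y in lborel. y \<notin> {sbar..sbar + 1}"
      using AE
    proof eventually_elim
      case (elim y)
      then show ?case using \<open>U x \<noteq> U sbar\<close> xy by auto
    qed
    then have "{sbar..sbar + 1} \<in> null_sets lborel"
      by (subst AE_iff_null_sets) auto
    then show False by (simp add: null_sets_def)
  qed
  from U 1 C_sbar show "C x = C sbar" by simp
qed

text \<open>
  At the least level \<open>z\<close> with \<open>C z = C sbar\<close>, almost every shock has the same optimal value from
  \<open>z\<close> and from \<open>sbar\<close>. A shock that is not covered completely from \<open>z\<close> would be cheaper from
  \<open>sbar\<close>, where more can be discharged. A shock \<open>w > 0\<close> that is covered completely transports the
  equality to the levels \<open>z - w\<close> and \<open>sbar - w\<close>, contradicting the choice of \<open>z\<close>. Positive shocks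
  occur because the mean stage cost is positive.
\<close>

lemma C_strict_antimono:
  assumes xy: "0 \<le> x" "x < y" "y \<le> sbar"
  shows "C y < C x"
proof (rule ccontr)
  assume "\<not> ?thesis"
  then have "C x = C y" using C_antimono[of x y] xy by simp
  then have "C x = C sbar" using C_flat xy by blast
  define A where "A = {z \<in> {0..sbar}. C z = C sbar}"
  have "closed A"
  proof -
    have "A = {0..sbar} \<inter> C -` {C sbar}" by (auto simp: A_def)
    then show ?thesis
      using continuous_closed_preimage[OF lipschitz_on_continuous_on[OF C_lipschitz], of "{C sbar}"] by simp
  qed
  moreover have "x \<in> A" using \<open>C x = C sbar\<close> xy by (simp add: A_def)
  moreover have bdd: "bdd_below A" by (auto simp: A_def intro: bdd_belowI[of _ 0])
  ultimately have "Inf A \<in> A" by (intro closed_contains_Inf) auto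
  define z where "z = Inf A"
  have z: "z \<in> {0..sbar}" "C z = C sbar" and z_least: "\<And>a. a \<in> A \<Longrightarrow> z \<le> a"
    using \<open>Inf A \<in> A\<close> cInf_lower[OF _ bdd] by (auto simp: z_def A_def)
  have "z < sbar" using z_least[OF \<open>x \<in> A\<close>] xy by simp
  have "U z = U sbar" using C_flat(2)[of z sbar] z \<open>z < sbar\<close> by simp
  have sbar: "sbar \<in> {0..sbar}" using sbar_pos by simp
  have m_mono: "m sbar w \<le> m z w" if w: "w \<in> {0..B}" for w
  proof -
    note u = policyD[OF greedy z(1) w]
    have "m sbar w \<le> stage_value C sbar w (greedy z w)"
      using u z by (intro m_le sbar w) auto
    also have "\<dots> \<le> m z w"
      using C_antimono[of "z - greedy z w" "sbar - greedy z w"] u z by (simp add: stage_value_def)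
    finally show ?thesis .
  qed
  note int = integrable_stage_value[OF greedy C_bounded_measurable]
  have "(\<integral>w. m z w - m sbar w \<partial>fW) = 0"
    using \<open>U z = U sbar\<close> by (simp add: int[OF z(1)] int[OF sbar] U_eq[OF z(1)] U_eq[OF sbar] shock_cost_eq)
  then have AE_eq: "AE w in fW. m z w - m sbar w = 0"
    by (subst (asm) integral_nonneg_eq_0_iff_AE)
       (auto intro!: Bochner_Integration.integrable_diff int z(1) sbar m_mono)
  have "\<exists>w\<in>{0..B}. 0 < w \<and> m z w = m sbar w"
  proof (rule ccontr)
    assume none: "\<not> ?thesis"
    have "AE w in fW. w \<in> {0..B}" by (rule AE_I2) simp
    with AE_eq have "AE w in fW. g w = 0"
    proof eventually_elim
      case (elim w)
      then have "\<not> 0 < w" using none by auto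
      then have "w = 0" using elim by simp
      then show ?case by (simp add: g_0)
    qed
    then have "(\<integral>w. g w \<partial>fW) = 0" by (rule integral_eq_zero_AE)
    with g_mean show False by simp
  qed
  then obtain w where w: "w \<in> {0..B}" "0 < w" and eq: "m z w = m sbar w" by blast
  let ?u = "greedy z w"
  note u = policyD[OF greedy z(1) w(1)]
  have "?u = w"
  proof (rule ccontr)
    assume "?u \<noteq> w"
    \<comment> \<open>From \<open>sbar\<close> one can discharge \<open>d\<close> more than from \<open>z\<close> and still end up at a level at least as high.\<close>
    define d where "d = min (sbar - z) (w - ?u)"
    have d: "0 < d" "d \<le> sbar - z" "d \<le> w - ?u" using \<open>?u \<noteq> w\<close> u \<open>z < sbar\<close> by (auto simp: d_def)
    have "m sbar w \<le> stage_value C sbar w (?u + d)"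
      using u d by (intro m_le sbar w) auto
    moreover have "g (w - (?u + d)) < g (w - ?u)" using u d w by (intro g_less) auto
    moreover have "C (sbar - (?u + d)) \<le> C (z - ?u)" using u d by (intro C_antimono) auto
    ultimately have "m sbar w < m z w" by (simp add: stage_value_def)
    with eq show False by simp
  qed
  then have "w \<le> z" using u(2) by simp
  have "m sbar w \<le> stage_value C sbar w w" using w \<open>w \<le> z\<close> z by (intro m_le sbar w) auto
  then have "C (z - w) \<le> C (sbar - w)"
    using eq unfolding stage_value_def \<open>?u = w\<close> by simp
  moreover have "C (sbar - w) \<le> C (z - w)"
    using \<open>w \<le> z\<close> \<open>z < sbar\<close> w by (intro C_antimono) auto
  ultimately have "C (z - w) = C (sbar - w)" by (rule antisym)
  then have "C (z - w) = C sbar"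
    using \<open>w \<le> z\<close> \<open>z < sbar\<close> w by (intro C_flat(1)[of "z - w" "sbar - w"]) auto
  then have "z - w \<in> A" using \<open>w \<le> z\<close> w z(1) by (simp add: A_def)
  then have "z \<le> z - w" by (rule z_least)
  then show False using w by simp
qed

text \<open>
  The expected shock costs of \<open>\<mu>\<close> dominate \<open>U\<close> and have the same image under \<open>renewal\<close>,
  so they agree at almost every level, and at \<open>sbar\<close>, where \<open>renewal\<close> only scales. At such a
  level the same argument applies to the integrals over the shocks.
\<close>

lemma optimal_cost_imp_minimizing:
  assumes \<mu>: "\<mu> \<in> policies sbar B" and opt: "\<And>s. s \<in> {0..sbar} \<Longrightarrow> Cpol \<mu> s = C s"
  shows "AE s in lborel. s \<in> {0..sbar} \<longrightarrow> (AE w in fW. minimizing_discharge g C s w (\<mu> s w))"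
    and "AE w in fW. minimizing_discharge g C sbar w (\<mu> sbar w)"
proof -
  let ?h = "shock_cost fW g (Cpol \<mu>) \<mu>"
  note h = shock_cost_bounded_measurable[OF \<mu> Cpol_bounded_measurable[OF \<mu>]]
  have h_eq: "?h s = shock_cost fW g C \<mu> s" if s: "s \<in> {0..sbar}" for s
    unfolding shock_cost_eq
    using opt[OF policyD(5)[OF \<mu> s]] by (intro Bochner_Integration.integral_cong) (auto simp: stage_value_def)
  have minimizing: "AE w in fW. minimizing_discharge g C s w (\<mu> s w)"
    if s: "s \<in> {0..sbar}" and eq: "U s = ?h s" for s
  proof -
    note int = integrable_stage_value[OF _ C_bounded_measurable s]
    have le: "m s w \<le> stage_value C s w (\<mu> s w)" if w: "w \<in> {0..B}" for w
      using policyD[OF \<mu> s w] by (intro m_le s w) auto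
    have "(\<integral>w. stage_value C s w (\<mu> s w) - m s w \<partial>fW) = 0"
      using eq unfolding h_eq[OF s] U_eq[OF s] unfolding shock_cost_eq by (simp add: int greedy \<mu>)
    then have "AE w in fW. stage_value C s w (\<mu> s w) - m s w = 0"
      by (subst (asm) integral_nonneg_eq_0_iff_AE)
         (auto intro!: Bochner_Integration.integrable_diff int \<mu> greedy le)
    moreover have "AE w in fW. w \<in> {0..B}" by (rule AE_I2) simp
    ultimately show ?thesis
    proof eventually_elim
      case (elim w)
      then show ?case
        using greedy_minimizing[OF s elim(2)] policyD(4)[OF \<mu> s elim(2)]
        by (simp add: minimizing_discharge_iff)
    qed
  qed
  have renewal_eq: "renewal U s = renewal ?h s" if "s \<in> {0..sbar}" for s
    using C_renewal[OF that] Cpol_renewal[OF \<mu> that] opt[OF that] by simp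
  have "contraction_factor * U sbar = contraction_factor * ?h sbar"
    using renewal_eq[of sbar] sbar_pos by (simp add: renewal_sbar U_bounded_measurable h)
  then show "AE w in fW. minimizing_discharge g C sbar w (\<mu> sbar w)"
    using contraction_factor_pos sbar_pos by (intro minimizing) auto
  have "AE s in lborel. 0 \<le> s \<longrightarrow> U (cap s) = ?h (cap s)"
    by (rule renewal_AE_eq[OF U_bounded_measurable h])
       (use U_le_shock_cost[OF \<mu>] renewal_eq[of 0] sbar_pos in auto)
  then show "AE s in lborel. s \<in> {0..sbar} \<longrightarrow> (AE w in fW. minimizing_discharge g C s w (\<mu> s w))"
  proof eventually_elim
    case (elim s)
    then show ?case by (auto intro: minimizing)
  qed
qed

lemma Cpol_has_derivative:
  assumes \<mu>: "\<mu> \<in> policies sbar B" and s: "s \<in> {0..sbar}"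
    and cont: "continuous (at s within {0..sbar}) (shock_cost fW g (Cpol \<mu>) \<mu>)"
  shows "(Cpol \<mu> has_real_derivative (rate * Cpol \<mu> s - Q / r * shock_cost fW g (Cpol \<mu>) \<mu> s))
    (at s within {0..sbar})"
  unfolding Cpol_renewal[OF \<mu> s]
  by (rule has_field_derivative_transform_within[OF renewal_has_derivative zero_less_one s,
        OF shock_cost_bounded_measurable[OF \<mu> Cpol_bounded_measurable[OF \<mu>]] s cont])
     (simp add: Cpol_renewal[OF \<mu>])

end

section \<open>Renewal equation for the cost of a policy\<close>

lemma nn_integral_PiM_nat_iter:
  assumes "prob_space M" and [measurable]: "f \<in> borel_measurable (\<Pi>\<^sub>M i\<in>(UNIV::nat set). M)"
  shows "(\<integral>\<^sup>+\<omega>. f \<omega> \<partial>(\<Pi>\<^sub>M i\<in>UNIV. M)) =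
    (\<integral>\<^sup>+x. \<integral>\<^sup>+\<omega>. f (case_nat x \<omega>) \<partial>(\<Pi>\<^sub>M i\<in>UNIV. M) \<partial>M)"
proof -
  interpret M: prob_space M by fact
  interpret sequence_space M by unfold_locales
  have "(\<integral>\<^sup>+\<omega>. f \<omega> \<partial>S) = (\<integral>\<^sup>+\<omega>. f \<omega> \<partial>distr (M \<Otimes>\<^sub>M S) S (\<lambda>(s, \<omega>). case_nat s \<omega>))"
    by (simp only: PiM_iter)
  also have "\<dots> = (\<integral>\<^sup>+p. f (case_nat (fst p) (snd p)) \<partial>(M \<Otimes>\<^sub>M S))"
    by (subst nn_integral_distr) (auto simp: split_beta')
  also have "\<dots> = (\<integral>\<^sup>+x. \<integral>\<^sup>+\<omega>. f (case_nat x \<omega>) \<partial>S \<partial>M)"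
    by (subst P.nn_integral_fst[symmetric]) auto
  finally show ?thesis .
qed

text \<open>
  The first elements of two independent sequences of independent variables split off, and the remaining
  sequences have the original laws. This is the renewal property at the first arrival.
\<close>

lemma nn_integral_PiM_pair_iter:
  assumes "prob_space M" "prob_space N"
    and F [measurable]: "case_prod F \<in> borel_measurable ((\<Pi>\<^sub>M i\<in>(UNIV::nat set). M) \<Otimes>\<^sub>M (\<Pi>\<^sub>M i\<in>(UNIV::nat set). N))"
  shows "(\<integral>\<^sup>+a. \<integral>\<^sup>+b. F a b \<partial>(\<Pi>\<^sub>M i\<in>UNIV. N) \<partial>(\<Pi>\<^sub>M i\<in>UNIV. M)) =
    (\<integral>\<^sup>+x. \<integral>\<^sup>+y. \<integral>\<^sup>+a. \<integral>\<^sup>+b. F (case_nat x a) (case_nat y b)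
       \<partial>(\<Pi>\<^sub>M i\<in>UNIV. N) \<partial>(\<Pi>\<^sub>M i\<in>UNIV. M) \<partial>N \<partial>M)"
proof -
  interpret M: prob_space M by fact
  interpret N: prob_space N by fact
  let ?SM = "\<Pi>\<^sub>M i\<in>(UNIV::nat set). M" and ?SN = "\<Pi>\<^sub>M i\<in>(UNIV::nat set). N"
  interpret SM: prob_space ?SM by (intro prob_space_PiM assms(1))
  interpret SN: prob_space ?SN by (intro prob_space_PiM assms(2))
  interpret P: pair_sigma_finite ?SM N by unfold_locales
  have "(\<integral>\<^sup>+a. \<integral>\<^sup>+b. F a b \<partial>?SN \<partial>?SM) = (\<integral>\<^sup>+x. \<integral>\<^sup>+a. \<integral>\<^sup>+b. F (case_nat x a) b \<partial>?SN \<partial>?SM \<partial>M)"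
    by (rule nn_integral_PiM_nat_iter[OF assms(1)]) measurable
  also have "\<dots> = (\<integral>\<^sup>+x. \<integral>\<^sup>+a. \<integral>\<^sup>+y. \<integral>\<^sup>+b. F (case_nat x a) (case_nat y b) \<partial>?SN \<partial>N \<partial>?SM \<partial>M)"
    by (intro nn_integral_cong nn_integral_PiM_nat_iter[OF assms(2)]) measurable
  also have "\<dots> = (\<integral>\<^sup>+x. \<integral>\<^sup>+y. \<integral>\<^sup>+a. \<integral>\<^sup>+b. F (case_nat x a) (case_nat y b) \<partial>?SN \<partial>?SM \<partial>N \<partial>M)"
    by (intro nn_integral_cong P.Fubini'[symmetric]) measurable
  finally show ?thesis .
qed

text \<open>
  Finiteness on the right makes the series converge almost everywhere, so that the real series, which
  has an arbitrary value where it diverges, represents the extended one.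
\<close>

lemma integral_suminf_nonneg:
  fixes f :: "nat \<Rightarrow> 'a \<Rightarrow> real"
  assumes [measurable]: "\<And>n. f n \<in> borel_measurable M" and nonneg: "\<And>n x. x \<in> space M \<Longrightarrow> 0 \<le> f n x"
    and fin: "(\<Sum>n. \<integral>\<^sup>+x. ennreal (f n x) \<partial>M) < \<infinity>"
  shows "(\<integral>x. (\<Sum>n. f n x) \<partial>M) = enn2real (\<Sum>n. \<integral>\<^sup>+x. ennreal (f n x) \<partial>M)"
proof -
  have sum: "(\<integral>\<^sup>+x. (\<Sum>n. ennreal (f n x)) \<partial>M) = (\<Sum>n. \<integral>\<^sup>+x. ennreal (f n x) \<partial>M)"
    by (rule nn_integral_suminf) measurable
  then have "AE x in M. (\<Sum>n. ennreal (f n x)) \<noteq> \<infinity>"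
    using fin by (intro nn_integral_PInf_AE) auto
  moreover have "AE x in M. x \<in> space M" by (rule AE_I2) 
  ultimately have AE: "AE x in M. 0 \<le> (\<Sum>n. f n x) \<and> ennreal (\<Sum>n. f n x) = (\<Sum>n. ennreal (f n x))"
  proof eventually_elim
    case (elim x)
    then have "summable (\<lambda>n. f n x)" by (intro summable_suminf_not_top) (auto simp: nonneg)
    then show ?case using elim by (simp add: suminf_ennreal2 nonneg suminf_nonneg)
  qed
  have "(\<integral>x. (\<Sum>n. f n x) \<partial>M) = enn2real (\<integral>\<^sup>+x. ennreal (\<Sum>n. f n x) \<partial>M)"
    using AE by (intro integral_eq_nn_integral) (auto elim: eventually_mono)
  also have "(\<integral>\<^sup>+x. ennreal (\<Sum>n. f n x) \<partial>M) = (\<integral>\<^sup>+x. (\<Sum>n. ennreal (f n x)) \<partial>M)"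
    using AE by (intro nn_integral_cong_AE) (auto elim: eventually_mono)
  finally show ?thesis by (simp add: sum)
qed

lemma measurable_PiM_nth:
  assumes "a \<in> measurable N (\<Pi>\<^sub>M i\<in>UNIV. M)"
  shows "(\<lambda>x. a x k) \<in> measurable N M"
  using measurable_compose[OF assms measurable_component_singleton[of k UNIV "\<lambda>_. M"]] by simp

lemma measurable_PiM_shift:
  assumes "a \<in> measurable N (\<Pi>\<^sub>M i\<in>(UNIV::nat set). M)"
  shows "(\<lambda>x k. a x (Suc k)) \<in> measurable N (\<Pi>\<^sub>M i\<in>UNIV. M)"
  by (rule measurable_PiM_single')
     (use measurable_PiM_nth[OF assms] measurable_space[OF measurable_PiM_nth[OF assms]] in auto)

context storage
begin

text \<open>
  The law of the time between two arrivals, without discounting; compare \<open>gap\<close>.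
\<close>

definition arrival_gap :: "real measure" where
  "arrival_gap = density lborel (exponential_density Q)"

lemma prob_space_arrival_gap: "prob_space arrival_gap"
  unfolding arrival_gap_def by (rule prob_space_exponential_density[OF Q_pos])

sublocale arrival_gap: prob_space arrival_gap
  by (rule prob_space_arrival_gap)

lemma sets_arrival_gap [simp, measurable_cong]: "sets arrival_gap = sets borel"
  and space_arrival_gap [simp]: "space arrival_gap = UNIV"
  by (simp_all add: arrival_gap_def)

lemma measurable_arrival_gap: "measurable arrival_gap N = measurable borel N"
  by (rule measurable_cong_sets) simp_all

lemma nn_integral_discounted:
  assumes [measurable]: "f \<in> borel_measurable borel"
  shows "(\<integral>\<^sup>+a. ennreal (exp (- \<theta> * a)) * f a \<partial>arrival_gap) = ennreal contraction_factor * (\<integral>\<^sup>+a. f a \<partial>gap)"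
proof -
  have eq: "exponential_density Q a * exp (- \<theta> * a) = contraction_factor * exponential_density (Q + \<theta>) a" for a
  proof -
    have "contraction_factor * (Q + \<theta>) = Q"
      using Q_pos \<theta>_pos by (simp add: contraction_factor_def)
    moreover have "exp (- a * (Q + \<theta>)) = exp (- a * Q) * exp (- \<theta> * a)"
      by (simp add: algebra_simps flip: exp_add)
    ultimately show ?thesis
      by (simp add: exponential_density_def mult.assoc flip: mult.assoc[of contraction_factor "Q + \<theta>"])
  qed
  have nonneg: "0 \<le> exponential_density Q a" "0 \<le> exponential_density (Q + \<theta>) a" for a
    using Q_pos \<theta>_pos by (simp_all add: exponential_density_nonneg)
  have "(\<integral>\<^sup>+a. ennreal (exp (- \<theta> * a)) * f a \<partial>arrival_gap)
      = (\<integral>\<^sup>+a. ennreal (exponential_density Q a) * (ennreal (exp (- \<theta> * a)) * f a) \<partial>lborel)"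
    unfolding arrival_gap_def by (subst nn_integral_density) auto
  also have "\<dots> = (\<integral>\<^sup>+a. ennreal contraction_factor * (ennreal (exponential_density (Q + \<theta>) a) * f a) \<partial>lborel)"
  proof (rule nn_integral_cong)
    fix a
    have "ennreal (exponential_density Q a) * ennreal (exp (- \<theta> * a))
        = ennreal contraction_factor * ennreal (exponential_density (Q + \<theta>) a)"
      using eq[of a] nonneg[of a] contraction_factor_pos by (simp flip: ennreal_mult)
    then show "ennreal (exponential_density Q a) * (ennreal (exp (- \<theta> * a)) * f a)
        = ennreal contraction_factor * (ennreal (exponential_density (Q + \<theta>) a) * f a)"
      by (simp add: mult.assoc[symmetric])
  qed
  also have "\<dots> = ennreal contraction_factor * (\<integral>\<^sup>+a. f a \<partial>gap)"
    unfolding gap_def by (subst nn_integral_cmult) (auto simp: nn_integral_density)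
  finally show ?thesis .
qed

text \<open>
  The term with index \<open>n\<close> of the cost, as a function of the gaps \<open>a\<close> between arrivals and of the
  shocks \<open>b\<close>, both indexed from 0. Recursion on the first arrival, rather than on the last one as in
  \<open>level_after\<close>, matches the renewal argument.
\<close>

primrec discounted_cost ::
  "(real \<Rightarrow> real \<Rightarrow> real) \<Rightarrow> nat \<Rightarrow> real \<Rightarrow> (nat \<Rightarrow> real) \<Rightarrow> (nat \<Rightarrow> real) \<Rightarrow> real" where
  "discounted_cost \<mu> 0 s a b =
     exp (- \<theta> * a 0) * g_ext (b 0 - \<mu> (cap (s + r * a 0)) (b 0))"
| "discounted_cost \<mu> (Suc n) s a b =
     exp (- \<theta> * a 0) * discounted_cost \<mu> n
       (cap (s + r * a 0) - \<mu> (cap (s + r * a 0)) (b 0)) (\<lambda>k. a (Suc k)) (\<lambda>k. b (Suc k))"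

lemma discounted_cost_nonneg: "0 \<le> discounted_cost \<mu> n s a b"
  by (induction n arbitrary: s a b) (auto simp: g_ext_nonneg)

lemma discounted_cost_measurable:
  assumes \<mu>: "\<mu> \<in> policies sbar B"
    and "f \<in> borel_measurable N" "a \<in> measurable N (\<Pi>\<^sub>M i\<in>UNIV. arrival_gap)" "b \<in> measurable N (\<Pi>\<^sub>M i\<in>UNIV. fW)"
  shows "(\<lambda>x. discounted_cost \<mu> n (f x) (a x) (b x)) \<in> borel_measurable N"
  using assms(2-)
proof (induction n arbitrary: f a b)
  case 0
  note [measurable] = 0(1) measurable_PiM_nth[OF 0(3), of 0] measurable_from_fW[OF measurable_PiM_nth[OF 0(3), of 0]] policy_measurable[OF \<mu>]
  have [measurable]: "(\<lambda>x. a x 0) \<in> borel_measurable N"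
    using measurable_PiM_nth[OF 0(2), of 0] by (simp cong: measurable_cong_sets)
  show ?case by simp
next
  case (Suc n)
  note [measurable] = Suc.prems(1) measurable_PiM_nth[OF Suc.prems(3), of 0]
    measurable_from_fW[OF measurable_PiM_nth[OF Suc.prems(3), of 0]] policy_measurable[OF \<mu>]
  have [measurable]: "(\<lambda>x. a x 0) \<in> borel_measurable N"
    using measurable_PiM_nth[OF Suc.prems(2), of 0] by (simp cong: measurable_cong_sets)
  show ?case
    unfolding discounted_cost.simps
    by (intro borel_measurable_times Suc.IH measurable_PiM_shift Suc.prems) measurable
qed

lemma level_after_Suc_shift:
  "level_after r sbar \<mu> t w s (Suc k) =
     level_after r sbar \<mu> (\<lambda>i. t (Suc i)) (\<lambda>i. w (Suc i)) (level_after r sbar \<mu> t w s (Suc 0)) k"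
proof (induction k)
  case (Suc k)
  then show ?case by (subst level_after.simps(2)) (simp only: level_after.simps(2))
qed simp

lemma discounted_cost_eq_path:
  assumes \<mu>: "\<mu> \<in> policies sbar B" and "s \<in> {0..sbar}"
    and "\<And>k. t k \<le> t (Suc k)" and "\<And>k. w (Suc k) \<in> {0..B}"
  shows "exp (- \<theta> * (t (Suc n) - t 0)) *
      g (w (Suc n) - \<mu> (level_before r sbar \<mu> t w s (Suc n)) (w (Suc n)))
    = discounted_cost \<mu> n s (\<lambda>k. t (Suc k) - t k) (\<lambda>k. w (Suc k))"
  using assms(2-)
proof (induction n arbitrary: s t w)
  case 0
  have "0 \<le> s + r * (t (Suc 0) - t 0)" using 0 r_pos by simp
  then have "charge r sbar s (t (Suc 0) - t 0) = cap (s + r * (t (Suc 0) - t 0))"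
    using sbar_pos by (auto simp: charge_def cap_def)
  then show ?case
    using policyD(6)[OF \<mu> cap_in(1) 0(3)[of 0]] by (simp add: level_before_def)
next
  case (Suc n)
  let ?x = "cap (s + r * (t (Suc 0) - t 0))"
  have "0 \<le> s + r * (t (Suc 0) - t 0)" using Suc.prems r_pos by simp
  then have x: "charge r sbar s (t (Suc 0) - t 0) = ?x"
    using sbar_pos by (auto simp: charge_def cap_def)
  have step: "level_after r sbar \<mu> t w s (Suc 0) = ?x - \<mu> ?x (w (Suc 0))"
    by (simp add: x Let_def)
  have before: "level_before r sbar \<mu> t w s (Suc (Suc n)) =
      level_before r sbar \<mu> (\<lambda>i. t (Suc i)) (\<lambda>i. w (Suc i)) (?x - \<mu> ?x (w (Suc 0))) (Suc n)"
    unfolding level_before_def diff_Suc_1 by (subst level_after_Suc_shift) (simp only: step)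
  have "exp (- \<theta> * (t (Suc (Suc n)) - t 0)) = exp (- \<theta> * (t (Suc 0) - t 0)) * exp (- \<theta> * (t (Suc (Suc n)) - t (Suc 0)))"
    by (simp add: algebra_simps flip: exp_add)
  then show ?case
    unfolding before discounted_cost.simps
    using Suc.IH[of "?x - \<mu> ?x (w (Suc 0))" "\<lambda>i. t (Suc i)" "\<lambda>i. w (Suc i)"]
      policyD(5)[OF \<mu> cap_in(1) Suc.prems(3)] Suc.prems(2,3)
    by (simp add: mult.assoc)
qed

abbreviation gap_seq :: "(nat \<Rightarrow> real) measure" where
  "gap_seq \<equiv> \<Pi>\<^sub>M i\<in>UNIV. arrival_gap"

abbreviation shock_seq :: "(nat \<Rightarrow> real) measure" where
  "shock_seq \<equiv> \<Pi>\<^sub>M i\<in>UNIV. fW"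

sublocale gap_seq: prob_space gap_seq
  by (intro prob_space_PiM prob_space_arrival_gap)

sublocale shock_seq: prob_space shock_seq
  by (intro prob_space_PiM fW.prob_space_axioms)

definition expected_cost :: "(real \<Rightarrow> real \<Rightarrow> real) \<Rightarrow> nat \<Rightarrow> real \<Rightarrow> ennreal" where
  "expected_cost \<mu> n s = (\<integral>\<^sup>+a. \<integral>\<^sup>+b. ennreal (discounted_cost \<mu> n s a b) \<partial>shock_seq \<partial>gap_seq)"

definition total_cost :: "(real \<Rightarrow> real \<Rightarrow> real) \<Rightarrow> real \<Rightarrow> ennreal" where
  "total_cost \<mu> s = (\<Sum>n. expected_cost \<mu> n s)"

lemma expected_cost_measurable:
  assumes \<mu>: "\<mu> \<in> policies sbar B"
  shows "expected_cost \<mu> n \<in> borel_measurable borel"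
proof -
  note [measurable] = discounted_cost_measurable[OF \<mu>]
  show ?thesis unfolding expected_cost_def[abs_def] by measurable
qed

lemma total_cost_measurable:
  assumes \<mu>: "\<mu> \<in> policies sbar B"
  shows "total_cost \<mu> \<in> borel_measurable borel"
proof -
  note [measurable] = expected_cost_measurable[OF \<mu>]
  show ?thesis unfolding total_cost_def[abs_def] by measurable
qed

lemma expected_cost_0:
  assumes \<mu>: "\<mu> \<in> policies sbar B"
  shows "expected_cost \<mu> 0 s =
    (\<integral>\<^sup>+a. ennreal (exp (- \<theta> * a)) * (\<integral>\<^sup>+b. ennreal (g_ext (b - \<mu> (cap (s + r * a)) b)) \<partial>fW) \<partial>arrival_gap)"
proof -
  note [measurable] = discounted_cost_measurable[OF \<mu>] policy_measurable[OF \<mu>]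
  have "expected_cost \<mu> 0 s = (\<integral>\<^sup>+a. \<integral>\<^sup>+b. ennreal (exp (- \<theta> * a)) *
      ennreal (g_ext (b - \<mu> (cap (s + r * a)) b)) \<partial>fW \<partial>arrival_gap)"
    unfolding expected_cost_def
    by (subst nn_integral_PiM_pair_iter[OF prob_space_arrival_gap fW.prob_space_axioms])
       (measurable, simp add: ennreal_mult g_ext_nonneg
          gap_seq.emeasure_space_1 shock_seq.emeasure_space_1)
  also have "\<dots> = (\<integral>\<^sup>+a. ennreal (exp (- \<theta> * a)) *
      (\<integral>\<^sup>+b. ennreal (g_ext (b - \<mu> (cap (s + r * a)) b)) \<partial>fW) \<partial>arrival_gap)"
    by (intro nn_integral_cong nn_integral_cmult) measurable
  finally show ?thesis .
qed

lemma expected_cost_Suc: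
  assumes \<mu>: "\<mu> \<in> policies sbar B"
  shows "expected_cost \<mu> (Suc n) s =
    (\<integral>\<^sup>+a. ennreal (exp (- \<theta> * a)) *
      (\<integral>\<^sup>+b. expected_cost \<mu> n (cap (s + r * a) - \<mu> (cap (s + r * a)) b) \<partial>fW) \<partial>arrival_gap)"
proof -
  note [measurable] = discounted_cost_measurable[OF \<mu>] policy_measurable[OF \<mu>] expected_cost_measurable[OF \<mu>]
  let ?x = "\<lambda>a b. cap (s + r * a) - \<mu> (cap (s + r * a)) b"
  have "expected_cost \<mu> (Suc n) s = (\<integral>\<^sup>+a\<^sub>0. \<integral>\<^sup>+b\<^sub>0. \<integral>\<^sup>+a. \<integral>\<^sup>+b. ennreal (exp (- \<theta> * a\<^sub>0)) *
      ennreal (discounted_cost \<mu> n (?x a\<^sub>0 b\<^sub>0) a b) \<partial>shock_seq \<partial>gap_seq \<partial>fW \<partial>arrival_gap)"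
    unfolding expected_cost_def
    by (subst nn_integral_PiM_pair_iter[OF prob_space_arrival_gap fW.prob_space_axioms])
       (measurable, simp add: ennreal_mult discounted_cost_nonneg)
  also have "\<dots> = (\<integral>\<^sup>+a\<^sub>0. \<integral>\<^sup>+b\<^sub>0. \<integral>\<^sup>+a. ennreal (exp (- \<theta> * a\<^sub>0)) *
      (\<integral>\<^sup>+b. ennreal (discounted_cost \<mu> n (?x a\<^sub>0 b\<^sub>0) a b) \<partial>shock_seq) \<partial>gap_seq \<partial>fW \<partial>arrival_gap)"
    by (intro nn_integral_cong nn_integral_cmult) measurable
  also have "\<dots> = (\<integral>\<^sup>+a\<^sub>0. \<integral>\<^sup>+b\<^sub>0. ennreal (exp (- \<theta> * a\<^sub>0)) * expected_cost \<mu> n (?x a\<^sub>0 b\<^sub>0) \<partial>fW \<partial>arrival_gap)"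
    unfolding expected_cost_def by (intro nn_integral_cong nn_integral_cmult) measurable
  also have "\<dots> = (\<integral>\<^sup>+a\<^sub>0. ennreal (exp (- \<theta> * a\<^sub>0)) * (\<integral>\<^sup>+b\<^sub>0. expected_cost \<mu> n (?x a\<^sub>0 b\<^sub>0) \<partial>fW) \<partial>arrival_gap)"
    by (intro nn_integral_cong nn_integral_cmult) measurable
  finally show ?thesis .
qed

text \<open>
  The equations of the single terms add up, because sums and integrals of nonnegative functions
  commute.
\<close>

lemma total_cost_renewal:
  assumes \<mu>: "\<mu> \<in> policies sbar B"
  shows "total_cost \<mu> s = ennreal contraction_factor *
    (\<integral>\<^sup>+a. (\<integral>\<^sup>+b. ennreal (g_ext (b - \<mu> (cap (s + r * a)) b)) +
        total_cost \<mu> (cap (s + r * a) - \<mu> (cap (s + r * a)) b) \<partial>fW) \<partial>gap)"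
proof -
  note [measurable] = policy_measurable[OF \<mu>] expected_cost_measurable[OF \<mu>] total_cost_measurable[OF \<mu>]
  let ?x = "\<lambda>a. cap (s + r * a)"
  let ?e = "\<lambda>a. ennreal (exp (- \<theta> * a))"
  have [measurable]:
    "(\<lambda>a. \<integral>\<^sup>+b. expected_cost \<mu> n (?x a - \<mu> (?x a) b) \<partial>fW) \<in> borel_measurable borel"
    "(\<lambda>a. \<integral>\<^sup>+b. total_cost \<mu> (?x a - \<mu> (?x a) b) \<partial>fW) \<in> borel_measurable borel"
    "(\<lambda>a. \<integral>\<^sup>+b. ennreal (g_ext (b - \<mu> (?x a) b)) \<partial>fW) \<in> borel_measurable borel" for n
    by measurable
  have "total_cost \<mu> s = expected_cost \<mu> 0 s + (\<Sum>n. expected_cost \<mu> (Suc n) s)"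
    unfolding total_cost_def by (subst suminf_offset[of _ 1]) (auto simp: add.commute)
  also have "(\<Sum>n. expected_cost \<mu> (Suc n) s) =
      (\<integral>\<^sup>+a. (\<Sum>n. ?e a * (\<integral>\<^sup>+b. expected_cost \<mu> n (?x a - \<mu> (?x a) b) \<partial>fW)) \<partial>arrival_gap)"
    unfolding expected_cost_Suc[OF \<mu>] by (rule nn_integral_suminf[symmetric]) (unfold measurable_arrival_gap, measurable)
  also have "\<dots> = (\<integral>\<^sup>+a. ?e a * (\<integral>\<^sup>+b. total_cost \<mu> (?x a - \<mu> (?x a) b) \<partial>fW) \<partial>arrival_gap)"
    unfolding total_cost_def by (simp add: nn_integral_suminf)
  also have "expected_cost \<mu> 0 s + \<dots> = (\<integral>\<^sup>+a. ?e a * (\<integral>\<^sup>+b. ennreal (g_ext (b - \<mu> (?x a) b)) \<partial>fW)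
      + ?e a * (\<integral>\<^sup>+b. total_cost \<mu> (?x a - \<mu> (?x a) b) \<partial>fW) \<partial>arrival_gap)"
    unfolding expected_cost_0[OF \<mu>] by (rule nn_integral_add[symmetric]) (unfold measurable_arrival_gap, measurable)
  also have "\<dots> = (\<integral>\<^sup>+a. ?e a * (\<integral>\<^sup>+b. ennreal (g_ext (b - \<mu> (?x a) b)) +
        total_cost \<mu> (?x a - \<mu> (?x a) b) \<partial>fW) \<partial>arrival_gap)"
    by (intro nn_integral_cong) (simp add: nn_integral_add distrib_left)
  also have "\<dots> = ennreal contraction_factor * (\<integral>\<^sup>+a. (\<integral>\<^sup>+b. ennreal (g_ext (b - \<mu> (?x a) b)) +
        total_cost \<mu> (?x a - \<mu> (?x a) b) \<partial>fW) \<partial>gap)"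
    by (rule nn_integral_discounted) measurable
  finally show ?thesis .
qed

text \<open>
  Every arrival contributes another factor \<open>contraction_factor\<close>, so the costs are dominated by a
  geometric series uniformly in the policy.
\<close>

lemma expected_cost_le:
  assumes \<mu>: "\<mu> \<in> policies sbar B"
  shows "expected_cost \<mu> n s \<le> ennreal (contraction_factor ^ Suc n * g B)"
proof (induction n arbitrary: s)
  note [measurable] = policy_measurable[OF \<mu>] expected_cost_measurable[OF \<mu>]
  have gB: "0 \<le> g B" using g_bounds(1)[of B] B_pos by simp
  have const: "(\<integral>\<^sup>+a. (\<integral>\<^sup>+b. c \<partial>fW) \<partial>gap) = c" for c
    by (simp only: nn_integral_const fW.emeasure_space_1 gap.emeasure_space_1 mult_1_right)
  have q: "ennreal contraction_factor * ennreal (contraction_factor ^ n * g B) = ennreal (contraction_factor ^ Suc n * g B)" for n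
    using contraction_factor_pos gB by (simp add: mult.assoc flip: ennreal_mult)
  {
    case 0
    have "expected_cost \<mu> 0 s = ennreal contraction_factor * (\<integral>\<^sup>+a. (\<integral>\<^sup>+b. ennreal (g_ext (b - \<mu> (cap (s + r * a)) b)) \<partial>fW) \<partial>gap)"
      unfolding expected_cost_0[OF \<mu>] by (rule nn_integral_discounted) measurable
    also have "\<dots> \<le> ennreal contraction_factor * (\<integral>\<^sup>+a. (\<integral>\<^sup>+b. ennreal (g B) \<partial>fW) \<partial>gap)"
      by (intro mult_left_mono nn_integral_mono ennreal_leI g_ext_le) simp
    finally show ?case using q[of 0] by (simp only: const) simp
  next
    case (Suc n)
    have "expected_cost \<mu> (Suc n) s = ennreal contraction_factor *
        (\<integral>\<^sup>+a. (\<integral>\<^sup>+b. expected_cost \<mu> n (cap (s + r * a) - \<mu> (cap (s + r * a)) b) \<partial>fW) \<partial>gap)"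
      unfolding expected_cost_Suc[OF \<mu>] by (rule nn_integral_discounted) measurable
    also have "\<dots> \<le> ennreal contraction_factor * (\<integral>\<^sup>+a. (\<integral>\<^sup>+b. ennreal (contraction_factor ^ Suc n * g B) \<partial>fW) \<partial>gap)"
      by (intro mult_left_mono nn_integral_mono Suc.IH) simp
    finally show ?case by (simp only: const q)
  }
qed

definition cost_bound :: real where
  "cost_bound = contraction_factor * g B / (1 - contraction_factor)"

lemma total_cost_le:
  assumes \<mu>: "\<mu> \<in> policies sbar B"
  shows "total_cost \<mu> s \<le> ennreal cost_bound"
proof -
  have gB: "0 \<le> g B" using g_bounds(1)[of B] B_pos by simp
  have "total_cost \<mu> s \<le> (\<Sum>n. ennreal (contraction_factor ^ Suc n * g B))"
    unfolding total_cost_def by (intro suminf_le expected_cost_le \<mu>) auto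
  also have "(\<lambda>n. contraction_factor ^ Suc n * g B) sums cost_bound"
    using sums_mult[OF geometric_sums[of contraction_factor], of "contraction_factor * g B"]
      contraction_factor_pos contraction_factor_less_1
    by (simp add: cost_bound_def mult_ac)
  then have "(\<Sum>n. ennreal (contraction_factor ^ Suc n * g B)) = ennreal cost_bound"
    using contraction_factor_pos gB by (intro suminf_ennreal_eq) auto
  finally show ?thesis .
qed

definition cost :: "(real \<Rightarrow> real \<Rightarrow> real) \<Rightarrow> real \<Rightarrow> real" where
  "cost \<mu> s = enn2real (total_cost \<mu> s)"

lemma ennreal_cost: "\<mu> \<in> policies sbar B \<Longrightarrow> ennreal (cost \<mu> s) = total_cost \<mu> s"
  unfolding cost_def using total_cost_le[of \<mu> s]
  by (intro ennreal_enn2real) (auto simp: le_less_trans)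

lemma cost_bounds:
  assumes "\<mu> \<in> policies sbar B"
  shows "cost \<mu> s \<in> {0..cost_bound}"
proof -
  have "0 \<le> cost_bound"
    using contraction_factor_pos contraction_factor_less_1 g_bounds(1)[of B] B_pos by (simp add: cost_bound_def)
  then show ?thesis
    using total_cost_le[OF assms] by (simp add: cost_def enn2real_leI)
qed

lemma cost_bounded_measurable:
  assumes \<mu>: "\<mu> \<in> policies sbar B"
  shows "bounded_measurable (cost \<mu>)"
proof (rule bounded_measurableI)
  note [measurable] = total_cost_measurable[OF \<mu>]
  show "(\<lambda>y. cost \<mu> (cap y)) \<in> borel_measurable borel" unfolding cost_def by measurable
  show "\<bar>cost \<mu> x\<bar> \<le> cost_bound" for x using cost_bounds[OF \<mu>, of x] by simp
qed

lemma cost_renewal: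
  assumes \<mu>: "\<mu> \<in> policies sbar B"
  shows "cost \<mu> s = renewal (shock_cost fW g (cost \<mu>) \<mu>) s"
proof -
  let ?h = "shock_cost fW g (cost \<mu>) \<mu>"
  note V = cost_bounded_measurable[OF \<mu>]
  have nonneg: "0 \<le> stage_value (cost \<mu>) x w (\<mu> x w)" if "x \<in> {0..sbar}" "w \<in> {0..B}" for x w
    using g_bounds(1)[OF policyD(6)[OF \<mu> that]] cost_bounds[OF \<mu>] by (simp add: stage_value_def)
  have inner: "(\<integral>\<^sup>+b. ennreal (g_ext (b - \<mu> x b)) + total_cost \<mu> (x - \<mu> x b) \<partial>fW) = ennreal (?h x)"
    if x: "x \<in> {0..sbar}" for x
  proof -
    have "(\<integral>\<^sup>+b. ennreal (g_ext (b - \<mu> x b)) + total_cost \<mu> (x - \<mu> x b) \<partial>fW)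
        = (\<integral>\<^sup>+b. ennreal (stage_value (cost \<mu>) x b (\<mu> x b)) \<partial>fW)"
    proof (rule nn_integral_cong)
      fix b assume "b \<in> space fW"
      then have b: "b \<in> {0..B}" by simp
      show "ennreal (g_ext (b - \<mu> x b)) + total_cost \<mu> (x - \<mu> x b) = ennreal (stage_value (cost \<mu>) x b (\<mu> x b))"
        using g_ext_eq[OF policyD(6)[OF \<mu> x b]] g_bounds(1)[OF policyD(6)[OF \<mu> x b]] cost_bounds[OF \<mu>]
        by (simp add: stage_value_def ennreal_plus flip: ennreal_cost[OF \<mu>])
    qed
    also have "\<dots> = ennreal (?h x)"
      unfolding shock_cost_eq
      by (intro nn_integral_eq_integral integrable_stage_value \<mu> V x AE_I2 nonneg) simp
    finally show ?thesis .
  qed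
  have h_nonneg: "0 \<le> ?h x" if "x \<in> {0..sbar}" for x
    unfolding shock_cost_eq using nonneg[OF that] by (intro integral_nonneg_AE AE_I2) simp
  have "ennreal (cost \<mu> s) = ennreal contraction_factor * (\<integral>\<^sup>+a. ennreal (?h (cap (s + r * a))) \<partial>gap)"
    unfolding ennreal_cost[OF \<mu>] by (subst total_cost_renewal[OF \<mu>]) (simp add: inner)
  also have "(\<integral>\<^sup>+a. ennreal (?h (cap (s + r * a))) \<partial>gap) = ennreal (\<integral>a. ?h (cap (s + r * a)) \<partial>gap)"
    by (intro nn_integral_eq_integral integrable_gap shock_cost_bounded_measurable \<mu> V AE_I2 h_nonneg cap_in)
  also have "ennreal contraction_factor * \<dots> = ennreal (renewal ?h s)"
    unfolding renewal_def using contraction_factor_pos by (simp add: ennreal_mult')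
  finally show ?thesis
    using cost_bounds[OF \<mu>, of s] contraction_factor_pos h_nonneg
    by (subst (asm) ennreal_inj) (auto simp: renewal_def intro!: mult_nonneg_nonneg integral_nonneg_AE)
qed

text \<open>
  The joint law of the gaps and the shocks is the product of the two sequence laws. Independence is
  given for the arrival times, and it passes to the gaps because these are a measurable function of the
  arrival times.
\<close>

lemma distr_gaps_shocks:
  assumes "prob_space M" and arrivals: "poisson_arrival_times M Q T"
    and shocks: "iid_shocks M fW W" and indep: "shocks_indep_of_arrivals M fW T W"
  defines "X \<equiv> \<lambda>\<omega> k. T (Suc k) \<omega> - T k \<omega>" and "Y \<equiv> \<lambda>\<omega> k. W (Suc k) \<omega>"
  shows "X \<in> measurable M gap_seq" "Y \<in> measurable M shock_seq"
    "distr M (gap_seq \<Otimes>\<^sub>M shock_seq) (\<lambda>\<omega>. (X \<omega>, Y \<omega>)) = gap_seq \<Otimes>\<^sub>M shock_seq"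
proof -
  interpret M: prob_space M by fact
  have sets_gap_seq: "sets gap_seq = sets (\<Pi>\<^sub>M i\<in>UNIV. borel)"
    by (intro sets_PiM_cong) auto
  have T0: "T 0 \<omega> = 0" if "\<omega> \<in> space M" for \<omega>
    using arrivals that by (simp add: poisson_arrival_times_def)
  have D: "distributed M lborel (\<lambda>\<omega>. T (Suc k) \<omega> - T k \<omega>) (exponential_density Q)" for k
    using arrivals by (simp add: poisson_arrival_times_def)
  have rv: "(\<lambda>\<omega>. T (Suc k) \<omega> - T k \<omega>) \<in> borel_measurable M" for k
    using distributed_measurable[OF D] by simp
  have "distr M borel (\<lambda>\<omega>. T (Suc k) \<omega> - T k \<omega>) = arrival_gap" for k
    using distributed_distr_eq_density[OF D[of k]] distr_cong[of M M borel lborel "\<lambda>\<omega>. T (Suc k) \<omega> - T k \<omega>"]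
    by (simp add: arrival_gap_def)
  moreover have "M.indep_vars (\<lambda>_. borel) (\<lambda>k \<omega>. T (Suc k) \<omega> - T k \<omega>) UNIV"
    using arrivals by (simp add: poisson_arrival_times_def)
  ultimately have X_distr: "distr M (\<Pi>\<^sub>M i\<in>UNIV. borel) X = gap_seq"
    using M.indep_vars_iff_distr_eq_PiM'[of UNIV "\<lambda>k \<omega>. T (Suc k) \<omega> - T k \<omega>" "\<lambda>_. borel"] rv
    by (simp add: X_def restrict_UNIV)
  have W_rv: "W k \<in> measurable M fW" "distr M fW (W k) = fW" if "1 \<le> k" for k
    using shocks that by (auto simp: iid_shocks_def)
  have "distr M (\<Pi>\<^sub>M i\<in>{1..}. fW) (\<lambda>\<omega>. \<lambda>i\<in>{1..}. W i \<omega>) = (\<Pi>\<^sub>M i\<in>{1..}. distr M fW (W i))"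
    using shocks M.indep_vars_iff_distr_eq_PiM'[of "{1..}" W "\<lambda>_. fW"] W_rv by (auto simp: iid_shocks_def)
  also have "\<dots> = (\<Pi>\<^sub>M i\<in>{1..}. fW)" by (intro PiM_cong) (auto simp: W_rv)
  finally have W_distr: "distr M (\<Pi>\<^sub>M i\<in>{1..}. fW) (\<lambda>\<omega>. \<lambda>i\<in>{1..}. W i \<omega>) = (\<Pi>\<^sub>M i\<in>{1..}. fW)" .
  have W_seq: "(\<lambda>\<omega>. \<lambda>i\<in>{1..}. W i \<omega>) \<in> measurable M (\<Pi>\<^sub>M i\<in>{1..}. fW)"
    by (intro measurable_restrict) (simp add: W_rv)
  have "(\<lambda>\<omega>. \<omega> (Suc k)) \<in> measurable (\<Pi>\<^sub>M i\<in>{1..}. fW) fW" for k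
    by (rule measurable_component_singleton) simp
  then have shift: "(\<lambda>\<omega> k. \<omega> (Suc k)) \<in> measurable (\<Pi>\<^sub>M i\<in>{1..}. fW) shock_seq"
    using measurable_restrict[of "UNIV::nat set" "\<lambda>k \<omega>. \<omega> (Suc k)" "\<Pi>\<^sub>M i\<in>{1..}. fW" "\<lambda>_. fW"]
    by (simp add: restrict_UNIV)
  have "distr (\<Pi>\<^sub>M i\<in>{1..}. fW) shock_seq (\<lambda>\<omega> k. \<omega> (Suc k)) = shock_seq"
    using distr_PiM_reindex[of "{1..}" "\<lambda>_. fW" Suc UNIV] fW.prob_space_axioms by (simp add: inj_on_def restrict_UNIV)
  then have "shock_seq = distr (distr M (\<Pi>\<^sub>M i\<in>{1..}. fW) (\<lambda>\<omega>. \<lambda>i\<in>{1..}. W i \<omega>)) shock_seq (\<lambda>\<omega> k. \<omega> (Suc k))"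
    by (simp only: W_distr)
  also have "\<dots> = distr M shock_seq Y"
    by (subst distr_distr[OF shift W_seq]) (simp add: Y_def comp_def)
  finally have Y_distr: "distr M shock_seq Y = shock_seq" ..
  have ind: "M.indep_var (\<Pi>\<^sub>M i\<in>UNIV. borel) (\<lambda>\<omega> k. T (Suc k) \<omega>) shock_seq Y"
    using indep by (simp add: shocks_indep_of_arrivals_def Y_def)
  \<comment> \<open>The first gap is the first arrival time itself, since \<open>T 0 = 0\<close>.\<close>
  let ?incr = "\<lambda>t k. t k - (case k of 0 \<Rightarrow> 0 | Suc j \<Rightarrow> t j) :: real"
  have incr: "?incr \<in> measurable (\<Pi>\<^sub>M i\<in>UNIV. borel) (\<Pi>\<^sub>M i\<in>UNIV. borel)"
  proof (rule measurable_PiM_single')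
    show "(\<lambda>t. ?incr t k) \<in> borel_measurable (\<Pi>\<^sub>M i\<in>UNIV. borel)" for k
      by (cases k) simp_all
  qed simp
  have "M.indep_var (\<Pi>\<^sub>M i\<in>UNIV. borel) (?incr \<circ> (\<lambda>\<omega> k. T (Suc k) \<omega>)) shock_seq ((\<lambda>y. y) \<circ> Y)"
    by (rule M.indep_var_compose[OF ind incr]) simp
  then have joint: "?incr \<circ> (\<lambda>\<omega> k. T (Suc k) \<omega>) \<in> measurable M (\<Pi>\<^sub>M i\<in>UNIV. borel)" "Y \<in> measurable M shock_seq"
    "distr M (\<Pi>\<^sub>M i\<in>UNIV. borel) (?incr \<circ> (\<lambda>\<omega> k. T (Suc k) \<omega>)) \<Otimes>\<^sub>M distr M shock_seq Y =
      distr M ((\<Pi>\<^sub>M i\<in>UNIV. borel) \<Otimes>\<^sub>M shock_seq) (\<lambda>\<omega>. ((?incr \<circ> (\<lambda>\<omega> k. T (Suc k) \<omega>)) \<omega>, Y \<omega>))"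
    unfolding M.indep_var_distribution_eq by (simp_all add: comp_def)
  have X_eq: "(?incr \<circ> (\<lambda>\<omega> k. T (Suc k) \<omega>)) \<omega> = X \<omega>" if "\<omega> \<in> space M" for \<omega>
    using T0[OF that] by (auto simp: X_def fun_eq_iff split: nat.split)
  show Y: "Y \<in> measurable M shock_seq" by (fact joint(2))
  have "X \<in> measurable M (\<Pi>\<^sub>M i\<in>UNIV. borel)"
    using joint(1) by (subst measurable_cong[OF X_eq[symmetric]])
  then show X: "X \<in> measurable M gap_seq"
    by (simp add: measurable_cong_sets[OF refl sets_gap_seq])
  have "gap_seq \<Otimes>\<^sub>M shock_seq = distr M ((\<Pi>\<^sub>M i\<in>UNIV. borel) \<Otimes>\<^sub>M shock_seq) (\<lambda>\<omega>. (X \<omega>, Y \<omega>))"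
    using joint(3) X_eq
    by (simp add: Y_distr X_distr cong: distr_cong)
  also have "\<dots> = distr M (gap_seq \<Otimes>\<^sub>M shock_seq) (\<lambda>\<omega>. (X \<omega>, Y \<omega>))"
    by (intro distr_cong sets_pair_measure_cong sets_gap_seq[symmetric] refl)
  finally show "distr M (gap_seq \<Otimes>\<^sub>M shock_seq) (\<lambda>\<omega>. (X \<omega>, Y \<omega>)) = gap_seq \<Otimes>\<^sub>M shock_seq" ..
qed

text \<open>
  Along every realisation the discounted stage costs are the values of \<open>discounted_cost\<close> at the gaps
  and shocks, whose joint law is known.
\<close>

lemma policy_cost_eq_cost:
  assumes "prob_space M" and arrivals: "poisson_arrival_times M Q T"
    and shocks: "iid_shocks M fW W" and indep: "shocks_indep_of_arrivals M fW T W"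
    and \<mu>: "\<mu> \<in> policies sbar B" and s: "s \<in> {0..sbar}"
  shows "policy_cost M T W r \<theta> sbar g \<mu> s = cost \<mu> s"
proof -
  let ?X = "\<lambda>\<omega> k. T (Suc k) \<omega> - T k \<omega>" and ?Y = "\<lambda>\<omega> k. W (Suc k) \<omega>"
  note XY = distr_gaps_shocks[OF assms(1-4)]
  note dc = discounted_cost_measurable[OF \<mu>]
  have path: "exp (- \<theta> * T (Suc n) \<omega>) * g (W (Suc n) \<omega> -
        \<mu> (level_before r sbar \<mu> (\<lambda>i. T i \<omega>) (\<lambda>i. W i \<omega>) s (Suc n)) (W (Suc n) \<omega>))
      = discounted_cost \<mu> n s (?X \<omega>) (?Y \<omega>)" if \<omega>: "\<omega> \<in> space M" for n \<omega>
  proof -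
    have "T 0 \<omega> = 0" "T k \<omega> \<le> T (Suc k) \<omega>" for k
      using arrivals \<omega> by (auto simp: poisson_arrival_times_def less_imp_le)
    moreover have "W (Suc k) \<omega> \<in> {0..B}" for k
      using shocks \<omega> measurable_space[of "W (Suc k)" M fW \<omega>] by (auto simp: iid_shocks_def)
    ultimately show ?thesis
      using discounted_cost_eq_path[OF \<mu> s, of "\<lambda>i. T i \<omega>" "\<lambda>i. W i \<omega>" n] by simp
  qed
  have expected: "(\<integral>\<^sup>+\<omega>. ennreal (discounted_cost \<mu> n s (?X \<omega>) (?Y \<omega>)) \<partial>M) = expected_cost \<mu> n s" for n
  proof -
    have meas: "(\<lambda>p. ennreal (discounted_cost \<mu> n s (fst p) (snd p))) \<in> borel_measurable (gap_seq \<Otimes>\<^sub>M shock_seq)"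
      by (intro measurable_compose[OF _ measurable_ennreal] dc) measurable
    have "(\<integral>\<^sup>+\<omega>. ennreal (discounted_cost \<mu> n s (?X \<omega>) (?Y \<omega>)) \<partial>M)
        = (\<integral>\<^sup>+p. ennreal (discounted_cost \<mu> n s (fst p) (snd p)) \<partial>distr M (gap_seq \<Otimes>\<^sub>M shock_seq) (\<lambda>\<omega>. (?X \<omega>, ?Y \<omega>)))"
      by (subst nn_integral_distr[OF measurable_Pair[OF XY(1,2)]]) (use meas in simp_all)
    also have "\<dots> = (\<integral>\<^sup>+p. ennreal (discounted_cost \<mu> n s (fst p) (snd p)) \<partial>(gap_seq \<Otimes>\<^sub>M shock_seq))"
      by (simp only: XY(3))
    also have "\<dots> = expected_cost \<mu> n s"
      unfolding expected_cost_def by (subst shock_seq.nn_integral_fst[OF meas, symmetric]) simp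
    finally show ?thesis .
  qed
  have "policy_cost M T W r \<theta> sbar g \<mu> s = (\<integral>\<omega>. (\<Sum>n. discounted_cost \<mu> n s (?X \<omega>) (?Y \<omega>)) \<partial>M)"
    unfolding policy_cost_def Let_def by (intro Bochner_Integration.integral_cong suminf_cong path refl)
  also have "\<dots> = enn2real (\<Sum>n. \<integral>\<^sup>+\<omega>. ennreal (discounted_cost \<mu> n s (?X \<omega>) (?Y \<omega>)) \<partial>M)"
  proof (rule integral_suminf_nonneg)
    show "(\<lambda>\<omega>. discounted_cost \<mu> n s (?X \<omega>) (?Y \<omega>)) \<in> borel_measurable M" for n
      by (intro dc XY(1,2)) simp
    show "(\<Sum>n. \<integral>\<^sup>+\<omega>. ennreal (discounted_cost \<mu> n s (?X \<omega>) (?Y \<omega>)) \<partial>M) < \<infinity>"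
      unfolding expected using total_cost_le[OF \<mu>, of s] by (simp add: total_cost_def le_less_trans)
  qed (rule discounted_cost_nonneg)
  also have "\<dots> = cost \<mu> s" by (simp add: expected cost_def total_cost_def)
  finally show ?thesis .
qed

end

section \<open>Structure of the optimal storage policy\<close>

theorem theorem2:
  fixes M :: "'a measure"
    and T W :: "nat \<Rightarrow> 'a \<Rightarrow> real"
    and fW :: "real measure"
    and r Q \<theta> sbar B :: real
    and g :: "real \<Rightarrow> real"
    and C :: "real \<Rightarrow> real"
    and Cpol :: "(real \<Rightarrow> real \<Rightarrow> real) \<Rightarrow> real \<Rightarrow> real"
  assumes params: "0 < r" "0 < Q" "0 < \<theta>" "0 < sbar" "0 < B"
    and prob: "prob_space M"
    and arrivals: "poisson_arrival_times M Q T"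
    and distribution: "shock_distribution B fW"
    and shocks: "iid_shocks M fW W"
    and indep: "shocks_indep_of_arrivals M fW T W"
    and g_bounded: "bounded (g ` {0..B})"
    and g_mono: "strict_mono_on {0..B} g"
    and g_C1: "continuously_differentiable_on g {0..B}"
    and g_0: "g 0 = 0"
    and g_mean: "(\<integral>w. g w \<partial>fW) > 0"
    and Cpol_eq: "Cpol = policy_cost M T W r \<theta> sbar g"
    and C_eq: "C = value_function M T W r \<theta> sbar B g"
  shows
    "strict_antimono_on {0..sbar} C
   \<and> (convex_on {0..B} g \<longrightarrow> convex_on {0..sbar} C)
   \<and> (continuously_differentiable_on C {0..sbar} \<longrightarrow>
        (\<forall>s\<in>{0..sbar}.
           (C has_real_derivative
              ((Q + \<theta>) / r * C s - Q / r * min_shock_cost fW g C s)) (at s within {0..sbar}))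
      \<and> (C has_real_derivative 0) (at sbar within {0..sbar})
      \<and> (\<exists>\<mu>. optimal_policy M T W r \<theta> sbar B g \<mu> \<and>
              (\<forall>s\<in>{0..sbar}. \<forall>w\<in>{0..B}. minimizing_discharge g C s w (\<mu> s w)))
      \<and> (\<forall>\<mu>. optimal_policy M T W r \<theta> sbar B g \<mu> \<longrightarrow>
              (AE s in lborel. s \<in> {0..sbar} \<longrightarrow>
                 (AE w in fW. minimizing_discharge g C s w (\<mu> s w)))
            \<and> (AE w in fW. minimizing_discharge g C sbar w (\<mu> sbar w))))
   \<and> (\<forall>\<mu>\<in>policies sbar B. Cpol \<mu> differentiable_on {0..sbar} \<longrightarrow>
        (AE s in lborel. s \<in> {0..sbar} \<longrightarrow>
           (Cpol \<mu> has_real_derivative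
              ((Q + \<theta>) / r * Cpol \<mu> s - Q / r * shock_cost fW g (Cpol \<mu>) \<mu> s))
             (at s within {0..sbar}))
      \<and> (\<forall>s\<in>{0..sbar}. continuous (at s within {0..sbar}) (shock_cost fW g (Cpol \<mu>) \<mu>) \<longrightarrow>
           (Cpol \<mu> has_real_derivative
              ((Q + \<theta>) / r * Cpol \<mu> s - Q / r * shock_cost fW g (Cpol \<mu>) \<mu> s))
             (at s within {0..sbar}))
      \<and> (Q + \<theta>) / r * Cpol \<mu> sbar - Q / r * shock_cost fW g (Cpol \<mu>) \<mu> sbar = 0
      \<and> (continuous (at sbar within {0..sbar}) (shock_cost fW g (Cpol \<mu>) \<mu>) \<longrightarrow>
           (Cpol \<mu> has_real_derivative 0) (at sbar within {0..sbar})))"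
proof -
  obtain L where L: "L-lipschitz_on {0..B} g"
    using continuously_differentiable_imp_lipschitz[OF g_C1] .
  interpret storage r Q \<theta> sbar B fW g L
    by unfold_locales (fact params distribution g_mono g_0 L g_mean)+
  have Cpol: "Cpol \<mu> s = cost \<mu> s" if "\<mu> \<in> policies sbar B" "s \<in> {0..sbar}" for \<mu> s
    unfolding Cpol_eq by (rule policy_cost_eq_cost[OF prob arrivals shocks indep that])
  interpret V: storage_costs r Q \<theta> sbar B fW g L Cpol cost_bound
  proof
    fix \<mu> assume \<mu>: "\<mu> \<in> policies sbar B"
    show "bounded_measurable (Cpol \<mu>)"
      using cost_bounded_measurable[OF \<mu>] bounded_measurable_cong[OF Cpol[OF \<mu>]] by simp
    fix s assume s: "s \<in> {0..sbar}"
    show "Cpol \<mu> s \<in> {0..cost_bound}" unfolding Cpol[OF \<mu> s] by (rule cost_bounds[OF \<mu>])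
    have "renewal (shock_cost fW g (Cpol \<mu>) \<mu>) s = renewal (shock_cost fW g (cost \<mu>) \<mu>) s"
    proof (rule renewal_cong)
      fix x assume x: "x \<in> {0..sbar}"
      show "shock_cost fW g (Cpol \<mu>) \<mu> x = shock_cost fW g (cost \<mu>) \<mu> x"
        unfolding shock_cost_def
        using Cpol[OF \<mu> policyD(5)[OF \<mu> x]] by (intro Bochner_Integration.integral_cong) auto
    qed
    then show "Cpol \<mu> s = renewal (shock_cost fW g (Cpol \<mu>) \<mu>) s"
      unfolding Cpol[OF \<mu> s] using cost_renewal[OF \<mu>] by simp
  qed
  have C: "C = V.C"
    by (rule ext) (simp only: C_eq value_function_def V.C_def, simp only: Cpol_eq)
  have sbar: "sbar \<in> {0..sbar}" using params by simp
  note rate_eq = rate_def[symmetric]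
  have boundary: "rate * (contraction_factor * x) - Q / r * x = 0" for x
    by (simp flip: rate_contraction)
  have optimal: "optimal_policy M T W r \<theta> sbar B g \<mu> \<longleftrightarrow>
      \<mu> \<in> policies sbar B \<and> (\<forall>s\<in>{0..sbar}. Cpol \<mu> s = C s)" for \<mu>
  proof
    assume opt: "optimal_policy M T W r \<theta> sbar B g \<mu>"
    then have \<mu>: "\<mu> \<in> policies sbar B"
      using sbar by (auto simp: optimal_policy_def is_arg_min_def)
    have "Cpol \<mu> s = C s" if s: "s \<in> {0..sbar}" for s
    proof (rule antisym)
      show "Cpol \<mu> s \<le> C s"
        unfolding C using opt s
        by (intro V.C_greatest) (auto simp: optimal_policy_def is_arg_min_linorder Cpol_eq)
      show "C s \<le> Cpol \<mu> s" unfolding C by (rule V.C_le[OF \<mu> s])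
    qed
    with \<mu> show "\<mu> \<in> policies sbar B \<and> (\<forall>s\<in>{0..sbar}. Cpol \<mu> s = C s)" by blast
  next
    assume *: "\<mu> \<in> policies sbar B \<and> (\<forall>s\<in>{0..sbar}. Cpol \<mu> s = C s)"
    then have "Cpol \<mu> s \<le> Cpol \<nu> s" if "\<nu> \<in> policies sbar B" "s \<in> {0..sbar}" for \<nu> s
      using V.C_le[OF that] that(2) by (simp add: C)
    with * show "optimal_policy M T W r \<theta> sbar B g \<mu>"
      by (simp add: optimal_policy_def is_arg_min_linorder Cpol_eq)
  qed
  have i: "strict_antimono_on {0..sbar} C"
    unfolding C by (rule monotone_onI) (auto intro: V.C_strict_antimono)
  have ii: "convex_on {0..B} g \<longrightarrow> convex_on {0..sbar} C"
    unfolding C by (blast intro: V.C_convex)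
  have HJB: "(C has_real_derivative (rate * C s - Q / r * min_shock_cost fW g C s)) (at s within {0..sbar})"
    if "s \<in> {0..sbar}" for s
    unfolding C by (rule V.C_has_derivative[OF that])
  have HJB_sbar: "(C has_real_derivative 0) (at sbar within {0..sbar})"
    using V.C_has_derivative[OF sbar] unfolding V.C_sbar boundary C .
  have "optimal_policy M T W r \<theta> sbar B g V.greedy"
    unfolding optimal C by (simp add: V.greedy V.C_eq_Cpol_greedy)
  then have ex: "\<exists>\<mu>. optimal_policy M T W r \<theta> sbar B g \<mu> \<and>
      (\<forall>s\<in>{0..sbar}. \<forall>w\<in>{0..B}. minimizing_discharge g C s w (\<mu> s w))"
    unfolding C using V.greedy_minimizing by blast
  have all: "(AE s in lborel. s \<in> {0..sbar} \<longrightarrow> (AE w in fW. minimizing_discharge g C s w (\<mu> s w)))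
      \<and> (AE w in fW. minimizing_discharge g C sbar w (\<mu> sbar w))"
    if "optimal_policy M T W r \<theta> sbar B g \<mu>" for \<mu>
    using V.optimal_cost_imp_minimizing[of \<mu>] that unfolding optimal C by blast
  have Cpol_sbar: "rate * Cpol \<mu> sbar - Q / r * shock_cost fW g (Cpol \<mu>) \<mu> sbar = 0"
    if \<mu>: "\<mu> \<in> policies sbar B" for \<mu>
    unfolding V.Cpol_renewal[OF \<mu> sbar]
      renewal_sbar[OF shock_cost_bounded_measurable[OF \<mu> V.Cpol_bounded_measurable[OF \<mu>]]]
    by (rule boundary)
  have policy: "(AE s in lborel. s \<in> {0..sbar} \<longrightarrow>
           (Cpol \<mu> has_real_derivative (rate * Cpol \<mu> s - Q / r * shock_cost fW g (Cpol \<mu>) \<mu> s))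
             (at s within {0..sbar}))
      \<and> (\<forall>s\<in>{0..sbar}. continuous (at s within {0..sbar}) (shock_cost fW g (Cpol \<mu>) \<mu>) \<longrightarrow>
           (Cpol \<mu> has_real_derivative (rate * Cpol \<mu> s - Q / r * shock_cost fW g (Cpol \<mu>) \<mu> s))
             (at s within {0..sbar}))
      \<and> rate * Cpol \<mu> sbar - Q / r * shock_cost fW g (Cpol \<mu>) \<mu> sbar = 0
      \<and> (continuous (at sbar within {0..sbar}) (shock_cost fW g (Cpol \<mu>) \<mu>) \<longrightarrow>
           (Cpol \<mu> has_real_derivative 0) (at sbar within {0..sbar}))"
    if \<mu>: "\<mu> \<in> policies sbar B" and diff: "Cpol \<mu> differentiable_on {0..sbar}" for \<mu>
  proof (intro conjI ballI impI)
    show "AE s in lborel. s \<in> {0..sbar} \<longrightarrow>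
           (Cpol \<mu> has_real_derivative (rate * Cpol \<mu> s - Q / r * shock_cost fW g (Cpol \<mu>) \<mu> s))
             (at s within {0..sbar})"
      by (rule renewal_AE_derivative[OF shock_cost_bounded_measurable[OF \<mu> V.Cpol_bounded_measurable[OF \<mu>]]
            V.Cpol_renewal[OF \<mu>] diff])
  qed (use V.Cpol_has_derivative[OF \<mu>] V.Cpol_has_derivative[OF \<mu> sbar] Cpol_sbar[OF \<mu>] in auto)
  show ?thesis
    unfolding rate_eq using i ii HJB HJB_sbar ex all policy by blast
qed

end
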